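(* Let $(u_0^{(j)})_{j=1,\dots,J}$ be an initial particle system in $\Omega$, and let $(u_t^{(j)},t\ge0)$, $j=1,\dots,J$, be a solution of the inflated constrained EKI flow. Assume that $$\eta_0:=\min_{z\in\mathcal S,\ \|z\|=1}\langle z,\widehat C(u_0)z\rangle>0.$$ Then for each $z\in\mathcal S$ with $\|z\|=1$ there exists $t_\circ>0$ such that $$\langle z,\widehat C(u_t)z\rangle\ge\frac{w}{(c+w\max(k_1,0))(t+b)}\qquad\text{for all }t\ge t_\circ,$$ where $a=\frac{(1-\rho_{t_\circ})c_{lip}^2\lambda_{max}J}{\sigma_{min}}$, $b=\frac{V_e(0)^{-1}J}{2\sigma_{min}}$, $c=2\sigma_{max}$, $k_1=\frac{(1-a)-\eta_{t_\circ}cb}{(1-a)b^a\eta_{t_\circ}}$ and $w=1-a>0$.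
   Context: Setting: $X=\mathbb{R}^d$, $G:X\to\mathbb{R}^K$ is a (possibly nonlinear) forward map, locally Lipschitz continuous with constant $c_{lip}>0$ (every point of $X$ has a neighbourhood on which $G$ is Lipschitz with constant $c_{lip}$); $y\in\mathbb{R}^K$ is given data, $\Gamma\in\mathbb{R}^{K\times K}$ and $C_0\in\mathbb{R}^{d\times d}$ are symmetric positive definite. $\Omega=\{u\in X: h_i(u)\le0,\ i=1,\dots,m\}$, where each $h_i:X\to\mathbb{R}$ is convex and continuously differentiable and there exists $u\in X$ with $h_i(u)<0$ for all $i$. $\tau>0$ is a penalty parameter and $\|\cdot\|$ is the Euclidean norm. Ensemble notation: for particles $u_t=(u_t^{(j)})_{j=1,\dots,J}$ in $X$, $J\ge2$, put $\bar u_t=\frac1J\sum_j u_t^{(j)}$, $\bar G(u_t)=\frac1J\sum_jG(u_t^{(j)})$, $\widehat C(u_t)=\frac1J\sum_j(u_t^{(j)}-\bar u_t)(u_t^{(j)}-\bar u_t)^T$, $\widehat C_t^{u,G}=\frac1J\sum_j(u_t^{(j)}-\bar u_t)(G(u_t^{(j)})-\bar G(u_t))^T$. Inflated constrained EKI flow: for $j=1,\dots,J$, $$\frac{\mathrm{d}u_t^{(j)}}{\mathrm{d}t}=-\widehat C_t^{u,G}\Gamma^{-1}(G(u_t^{(j)})-y)-\widehat C(u_t)C_0^{-1}u_t^{(j)}+\rho_t\,\widehat C_t^{u,G}\Gamma^{-1}(G(u_t^{(j)})-\bar G(u_t))+\frac1\tau\widehat C(u_t)\sum_{i=1}^m\frac{1}{h_i(\bar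 u_t)}\nabla h_i(\bar u_t),$$ where the covariance inflation factor satisfies $0\le\rho_t\le1$ for all $t\ge0$ and $\rho_t\to1$ as $t\to\infty$. Affine subspace: $\mathcal S=u_0^\perp+\mathrm{span}\{u_0^{(j)}-\bar u_0:\ j=1,\dots,J\}$ with $u_0^\perp=\bar u_0-\mathcal P_E\bar u_0$, where $\mathcal P_E$ is the orthogonal projection onto $\mathrm{span}\{u_0^{(j)}-\bar u_0:\ j=1,\dots,J\}$. For $t\ge0$, $\eta_t=\min_{z\in\mathcal S,\|z\|=1}\langle z,\widehat C(u_t)z\rangle$. $V_e(t)=\frac1J\sum_{j=1}^J\frac12\|u_t^{(j)}-\bar u_t\|^2$. $\sigma_{min},\sigma_{max}$ are the smallest and largest eigenvalues of $C_0^{-1}$, and $\lambda_{max}$ is the largest eigenvalue of $\Gamma^{-1}$. *)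

theory Defs
  imports "HOL-Analysis.Analysis"
begin

definition locally_lipschitz_const ::
  "real \<Rightarrow> ('a::metric_space \<Rightarrow> 'b::metric_space) \<Rightarrow> bool" where
  "locally_lipschitz_const c f \<longleftrightarrow> (\<forall>x. \<exists>U. open U \<and> x \<in> U \<and> c-lipschitz_on U f)"

definition sym_pos_def :: "real^'n^'n \<Rightarrow> bool" where
  "sym_pos_def A \<longleftrightarrow> transpose A = A \<and> (\<forall>x. x \<noteq> 0 \<longrightarrow> x \<bullet> (A *v x) > 0)"

definition eigenvalues :: "real^'n^'n \<Rightarrow> real set" where
  "eigenvalues A = {l. \<exists>v. v \<noteq> 0 \<and> A *v v = l *\<^sub>R v}"

definition feasible_set :: "nat \<Rightarrow> (nat \<Rightarrow> 'a \<Rightarrow> real) \<Rightarrow> 'a set" where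
  "feasible_set m h = {x. \<forall>i\<in>{1..m}. h i x \<le> 0}"

text \<open>An ensemble of J particles is a function on the indices 1, ..., J; its values at other
  indices are irrelevant.\<close>

definition mean :: "nat \<Rightarrow> (nat \<Rightarrow> 'a::real_vector) \<Rightarrow> 'a" where
  "mean J v = (1 / real J) *\<^sub>R (\<Sum>j\<in>{1..J}. v j)"

definition outer :: "real^'m \<Rightarrow> real^'n \<Rightarrow> real^'n^'m" where
  "outer v w = (\<chi> i l. v $ i * w $ l)"

definition cross_cov :: "nat \<Rightarrow> (nat \<Rightarrow> real^'m) \<Rightarrow> (nat \<Rightarrow> real^'n) \<Rightarrow> real^'n^'m" where
  "cross_cov J v w =
     (1 / real J) *\<^sub>R (\<Sum>j\<in>{1..J}. outer (v j - mean J v) (w j - mean J w))"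

abbreviation cov :: "nat \<Rightarrow> (nat \<Rightarrow> real^'n) \<Rightarrow> real^'n^'n" where
  "cov J v \<equiv> cross_cov J v v"

definition ensemble_var :: "nat \<Rightarrow> (nat \<Rightarrow> real^'n) \<Rightarrow> real" where
  "ensemble_var J v = (1 / real J) * (\<Sum>j\<in>{1..J}. (1/2) * (norm (v j - mean J v))\<^sup>2)"

definition orth_proj :: "'a::euclidean_space set \<Rightarrow> 'a \<Rightarrow> 'a" where
  "orth_proj E x = (THE p. p \<in> E \<and> (\<forall>e\<in>E. (x - p) \<bullet> e = 0))"

definition deviation_span :: "nat \<Rightarrow> (nat \<Rightarrow> 'a::real_vector) \<Rightarrow> 'a set" where
  "deviation_span J v = span ((\<lambda>j. v j - mean J v) ` {1..J})"

definition ensemble_affine :: "nat \<Rightarrow> (nat \<Rightarrow> 'a::euclidean_space) \<Rightarrow> 'a set" where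
  "ensemble_affine J v =
     (\<lambda>e. (mean J v - orth_proj (deviation_span J v) (mean J v)) + e) ` deviation_span J v"

text \<open>Minimum of the quadratic form of the covariance at time t over the unit vectors of the
  affine space of the \<^emph>\<open>initial\<close> ensemble. By compactness the minimum is attained whenever that
  set of unit vectors is nonempty; otherwise the value is unspecified.\<close>

definition eta :: "nat \<Rightarrow> (real \<Rightarrow> nat \<Rightarrow> real^'d) \<Rightarrow> real \<Rightarrow> real" where
  "eta J u t =
     (LEAST r. \<exists>z\<in>ensemble_affine J (u 0). norm z = 1 \<and> r = z \<bullet> (cov J (u t) *v z))"

text \<open>In the flow below, \<open>dh i\<close> plays the role of the gradient of \<open>h i\<close>.
  Because division by zero yields zero in HOL, a solution must be required explicitly to stay
  where the right-hand side is defined. By continuity each \<open>h i\<close> then has constant sign along the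
  ensemble mean, so it stays negative if the initial particles are feasible and \<open>h i\<close> is convex.\<close>

definition eki_rhs ::
  "nat \<Rightarrow> (real^'d \<Rightarrow> real^'k) \<Rightarrow> real^'k \<Rightarrow> real^'k^'k \<Rightarrow> real^'d^'d \<Rightarrow>
   nat \<Rightarrow> (nat \<Rightarrow> real^'d \<Rightarrow> real) \<Rightarrow> (nat \<Rightarrow> real^'d \<Rightarrow> real^'d) \<Rightarrow> real \<Rightarrow> real \<Rightarrow>
   (nat \<Rightarrow> real^'d) \<Rightarrow> nat \<Rightarrow> real^'d" where
  "eki_rhs J G y \<Gamma> C0 m h dh \<tau> r v j =
     - (cross_cov J v (\<lambda>l. G (v l)) *v (matrix_inv \<Gamma> *v (G (v j) - y)))
     - cov J v *v (matrix_inv C0 *v v j)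
     + r *\<^sub>R (cross_cov J v (\<lambda>l. G (v l)) *v
             (matrix_inv \<Gamma> *v (G (v j) - mean J (\<lambda>l. G (v l)))))
     + (1 / \<tau>) *\<^sub>R (cov J v *v
             (\<Sum>i\<in>{1..m}. (1 / h i (mean J v)) *\<^sub>R dh i (mean J v)))"

definition eki_solution ::
  "nat \<Rightarrow> (real^'d \<Rightarrow> real^'k) \<Rightarrow> real^'k \<Rightarrow> real^'k^'k \<Rightarrow> real^'d^'d \<Rightarrow>
   nat \<Rightarrow> (nat \<Rightarrow> real^'d \<Rightarrow> real) \<Rightarrow> (nat \<Rightarrow> real^'d \<Rightarrow> real^'d) \<Rightarrow> real \<Rightarrow> (real \<Rightarrow> real) \<Rightarrow>
   (real \<Rightarrow> nat \<Rightarrow> real^'d) \<Rightarrow> bool" where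
  "eki_solution J G y \<Gamma> C0 m h dh \<tau> \<rho> u \<longleftrightarrow>
     (\<forall>t\<ge>0. (\<forall>i\<in>{1..m}. h i (mean J (u t)) \<noteq> 0) \<and>
       (\<forall>j\<in>{1..J}. ((\<lambda>s. u s j) has_vector_derivative
          eki_rhs J G y \<Gamma> C0 m h dh \<tau> (\<rho> t) (u t) j) (at t within {0..})))"

end

theory Submission
  imports Defs
begin

text \<open>
  Write \<open>q t z\<close> for the quadratic form of the empirical covariance at \<open>z\<close>. The deviations of the
  particles from their mean satisfy a closed system in which the data, the penalty terms and all
  other common terms have cancelled, and it gives
  \<open>q' = - 2 (1 - \<rho>) \<langle>D z, \<Gamma>\<inverse> D z\<rangle> - 2 \<langle>C z, C\<^sub>0\<inverse> C z\<rangle>\<close>, where \<open>C\<close> is the covariance and \<open>D\<close> the cross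
  covariance with the image particles. The theorem follows from the fact that \<open>q t z\<close> is of exact
  order \<open>1 / t\<close> for late \<open>t\<close>, uniformly over the unit vectors \<open>z\<close> of the affine space.

  Upper bound (\<open>q_decay\<close>): dropping the first term and using \<open>q \<le> norm (C z)\<close>, one gets a
  Riccati inequality. In particular the trace of the covariance is \<open>O(1 / t)\<close>.

  Lower bound (\<open>q_lower_on_K\<close>): at a minimizer over the unit sphere of the deviation span, \<open>z\<close> is an
  eigenvector, so the second term is of order \<open>q\<^sup>2\<close>. As \<open>G\<close> is globally Lipschitz, the first is at
  most \<open>(1 - \<rho>) q\<close> times the trace, that is \<open>(1 - \<rho>) O(1 / t) q\<close>, which is small compared with \<open>q / t\<close>
  because \<open>\<rho>\<close> tends to one. A cruder form of the same estimate shows that \<open>q\<close> stays positive on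
  the span up to any finite time (\<open>q_pos_on_K\<close>). So, from a late time on, \<open>t q\<close> starts above a
  sufficiently small level and cannot cross it; \<open>parametric_barrier\<close> makes this precise without
  differentiating an eigenvalue.
  The span is invariant, and orthogonality of the offset transfers the bound to the affine space
  (\<open>ensemble_covariance_decay_rate\<close>), giving \<open>q t z \<ge> \<kappa> / t\<close> for \<open>t \<ge> T\<close> with some \<open>\<kappa> > 0\<close>.

  The explicit constants then come for free from the freedom in choosing the time \<open>t0\<close>: by the
  upper bound \<open>eta\<close> tends to zero, so \<open>k1\<close>, which behaves like the inverse of \<open>eta\<close> at \<open>t0\<close>, tends to
  infinity. Hence \<open>w / (c + w * max k1 0) \<le> \<kappa>\<close> once \<open>t0\<close> is large (\<open>eventually_rate_le\<close>), and
  \<open>\<kappa> / t \<ge> \<kappa> / (t + b)\<close>.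
\<close>

section \<open>Minimizers of quadratic forms and a barrier principle\<close>

text \<open>The first-order condition. Perturbing the minimizer \<open>z\<close> in the direction of the residual
  \<open>w = f z - l *\<^sub>R z\<close>, where \<open>l = z \<bullet> f z\<close>, changes the nonnegative quantity
  \<open>x \<bullet> f x - l * (x \<bullet> x)\<close> by \<open>2 * s * (w \<bullet> w)\<close> up to second order in \<open>s\<close>, which for small
  negative \<open>s\<close> is only possible if \<open>w = 0\<close>.\<close>
lemma Rayleigh_minimizer_is_eigenvector:
  fixes f :: "'a::real_inner \<Rightarrow> 'a"
  assumes "linear f" and sym: "\<And>x y. x \<in> E \<Longrightarrow> y \<in> E \<Longrightarrow> x \<bullet> f y = f x \<bullet> y"
    and "subspace E" and inv: "\<And>x. x \<in> E \<Longrightarrow> f x \<in> E"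
    and z: "z \<in> E" "norm z = 1"
    and min: "\<And>x. x \<in> E \<Longrightarrow> norm x = 1 \<Longrightarrow> z \<bullet> f z \<le> x \<bullet> f x"
  shows "f z = (z \<bullet> f z) *\<^sub>R z"
proof -
  interpret linear f by fact
  define l where "l = z \<bullet> f z"
  have ge: "l * (x \<bullet> x) \<le> x \<bullet> f x" if "x \<in> E" for x
  proof (cases "x = 0")
    case True
    then show ?thesis by (simp add: zero)
  next
    case False
    have "l \<le> (x /\<^sub>R norm x) \<bullet> f (x /\<^sub>R norm x)"
      unfolding l_def using that False \<open>subspace E\<close> by (intro min) (auto simp: subspace_scale)
    also have "\<dots> = (x \<bullet> f x) / (norm x)\<^sup>2"
      by (simp add: scaleR power2_eq_square divide_simps)
    finally show ?thesis
      using False by (simp add: pos_le_divide_eq dot_square_norm)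
  qed
  define w where "w = f z - l *\<^sub>R z"
  have w: "w \<in> E"
    unfolding w_def using z inv \<open>subspace E\<close> by (intro subspace_diff subspace_scale) auto
  have zz: "z \<bullet> z = 1"
    using z by (simp add: dot_square_norm)
  have "0 \<le> 2 * s * (w \<bullet> w) + s\<^sup>2 * (w \<bullet> f w - l * (w \<bullet> w))" for s
  proof -
    have "z + s *\<^sub>R w \<in> E"
      using z w \<open>subspace E\<close> by (simp add: subspace_add subspace_scale)
    from ge[OF this] have "l * (z \<bullet> z) + 2 * s * l * (w \<bullet> z) + s\<^sup>2 * l * (w \<bullet> w)
        \<le> z \<bullet> f z + s * (w \<bullet> f z) + s * (z \<bullet> f w) + s\<^sup>2 * (w \<bullet> f w)"
      by (simp add: add scaleR inner_simps algebra_simps power2_eq_square inner_commute)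
    moreover have "z \<bullet> f w = w \<bullet> f z"
      using sym[OF z(1) w] by (simp add: inner_commute)
    moreover have "w \<bullet> f z = w \<bullet> w + l * (w \<bullet> z)"
      by (simp add: w_def inner_simps algebra_simps)
    ultimately show ?thesis
      using zz by (simp add: l_def algebra_simps)
  qed
  note quad = this
  have "w \<bullet> w \<le> 0"
  proof (rule ccontr)
    assume "\<not> w \<bullet> w \<le> 0"
    then have p: "w \<bullet> w > 0" by linarith
    define k where "k = w \<bullet> f w - l * (w \<bullet> w)"
    \<comment> \<open>The step is small enough for the linear term to dominate the quadratic one.\<close>
    define s where "s = - (w \<bullet> w) / (\<bar>k\<bar> + 1)"
    have s: "s < 0" using p by (simp add: s_def divide_neg_pos)
    have "0 \<le> s * (2 * (w \<bullet> w) + s * k)"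
      using quad[of s] by (simp add: k_def algebra_simps power2_eq_square)
    then have "2 * (w \<bullet> w) + s * k \<le> 0"
      using s by (simp add: zero_le_mult_iff)
    moreover have "s * k \<ge> - (w \<bullet> w)"
    proof -
      have "(w \<bullet> w) * k \<le> (w \<bullet> w) * (\<bar>k\<bar> + 1)"
        using p by (intro mult_left_mono) auto
      then show ?thesis
        by (simp add: s_def field_simps)
    qed
    ultimately show False using p by simp
  qed
  then have "w = 0"
    using inner_gt_zero_iff[of w] by linarith
  then show ?thesis by (simp add: w_def l_def)
qed

text \<open>At the earliest point \<open>(s, x)\<close> with \<open>F s x \<le> k\<close>, continuity forces \<open>x\<close> to be a minimizer of
  \<open>F s\<close> with value \<open>k\<close>, and a positive derivative there contradicts \<open>F > k\<close> at earlier times. The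
  derivative is taken at a fixed touching point, never of the minimum over \<open>K\<close>, which need not be
  differentiable in time.\<close>
lemma parametric_barrier:
  fixes F :: "real \<Rightarrow> 'a::t2_space \<Rightarrow> real"
  assumes cont: "continuous_on ({T..} \<times> K) (\<lambda>(t, z). F t z)" and "compact K"
    and start: "\<And>z. z \<in> K \<Longrightarrow> F T z > k"
    and touch: "\<And>t z. t > T \<Longrightarrow> z \<in> K \<Longrightarrow> F t z = k \<Longrightarrow> (\<And>x. x \<in> K \<Longrightarrow> F t x \<ge> k) \<Longrightarrow>
      \<exists>D>0. ((\<lambda>s. F s z) has_real_derivative D) (at t)"
    and "t \<ge> T" "z \<in> K"
  shows "F t z > k"
proof (rule ccontr)
  assume "\<not> F t z > k"
  define W where "W = ({T..t} \<times> K) \<inter> (\<lambda>(t, z). F t z) -` {..k}"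
  have contW: "continuous_on ({T..t} \<times> K) (\<lambda>(t, z). F t z)"
    by (rule continuous_on_subset[OF cont]) auto
  have cpt: "compact ({T..t} \<times> K)"
    using \<open>compact K\<close> by (intro compact_Times) auto
  have "closedin (top_of_set ({T..t} \<times> K)) W"
    unfolding W_def by (intro continuous_closedin_preimage contW) auto
  then have "compact W"
    using cpt closedin_compact by blast
  moreover have "(t, z) \<in> W"
    using \<open>\<not> F t z > k\<close> \<open>t \<ge> T\<close> \<open>z \<in> K\<close> by (simp add: W_def)
  ultimately obtain p where p: "p \<in> W" "\<And>p'. p' \<in> W \<Longrightarrow> fst p \<le> fst p'"
    using continuous_attains_inf[of W fst] continuous_on_fst[OF continuous_on_id] by blast
  obtain s x where sx: "p = (s, x)" by force
  have s: "T \<le> s" "s \<le> t" "x \<in> K" "F s x \<le> k"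
    using p(1) by (auto simp: sx W_def)
  have before: "F s' x' > k" if "T \<le> s'" "s' < s" "x' \<in> K" for s' x'
    using p(2)[of "(s', x')"] that s by (force simp: sx W_def)
  have "s \<noteq> T"
    using start s by force
  then have "T < s" using s by simp
  have ge: "F s x' \<ge> k" if "x' \<in> K" for x'
  proof -
    have "continuous_on {T..s} (\<lambda>s'. (\<lambda>(t, z). F t z) (s', x'))"
      by (rule continuous_on_compose2[OF cont]) (use that in \<open>auto intro!: continuous_intros\<close>)
    then have c: "continuous_on {T..s} (\<lambda>s'. F s' x')" by simp
    have "closure {T<..<s} = {T..s}"
      using \<open>T < s\<close> by simp
    moreover have "k \<le> F s x'"
      by (rule continuous_ge_on_closure[of "{T<..<s}" "\<lambda>s'. F s' x'"])
        (use c \<open>T < s\<close> before that in \<open>auto intro: less_imp_le\<close>)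
    ultimately show ?thesis by simp
  qed
  then have "F s x = k" using s by (simp add: order_antisym)
  then obtain D where "D > 0" "((\<lambda>s. F s x) has_real_derivative D) (at s)"
    using touch \<open>T < s\<close> s ge by blast
  then obtain d where d: "d > 0" "\<And>h. 0 < h \<Longrightarrow> h < d \<Longrightarrow> F (s - h) x < F s x"
    using DERIV_pos_inc_left by blast
  define h where "h = min (d / 2) (s - T)"
  have "F (s - h) x < F s x"
    using d \<open>T < s\<close> by (intro d) (auto simp: h_def min_def)
  moreover have "F (s - h) x > k"
    using d \<open>T < s\<close> s by (intro before) (auto simp: h_def)
  ultimately show False using \<open>F s x = k\<close> by simp
qed

section \<open>Decay of the covariance of a deviation flow\<close>

text \<open>The deviations \<open>e t j\<close> of the particles and \<open>g t j\<close> of their images from the respective ensemble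
  means obey a closed system: every term of the flow that is common to all particles cancels. Here
  \<open>r = 1 - \<rho>\<close>, while \<open>A\<close> and \<open>B\<close> stand for \<open>C\<^sub>0\<close> inverse and \<open>\<Gamma>\<close> inverse. The map \<open>G\<close> enters
  only through the inequality between the sums of squares, with \<open>L\<close> the square of its Lipschitz
  constant.\<close>
locale deviation_flow =
  fixes J :: nat and e :: "real \<Rightarrow> nat \<Rightarrow> 'a::euclidean_space"
    and g :: "real \<Rightarrow> nat \<Rightarrow> 'b::real_inner" and r :: "real \<Rightarrow> real"
    and A :: "'a \<Rightarrow> 'a" and B :: "'b \<Rightarrow> 'b" and \<alpha> \<beta> \<gamma> L :: real
  assumes J_pos: "J > 0" and linear_A: "linear A" and linear_B: "linear B"
    and flow: "\<And>t j. t \<ge> 0 \<Longrightarrow> j \<in> {1..J} \<Longrightarrow>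
      ((\<lambda>s. e s j) has_vector_derivative
        - ((1 / real J) *\<^sub>R (\<Sum>l\<in>{1..J}.
            (r t * (g t l \<bullet> B (g t j)) + e t l \<bullet> A (e t j)) *\<^sub>R e t l))) (at t within {0..})"
    and r_nonneg: "\<And>t. t \<ge> 0 \<Longrightarrow> 0 \<le> r t" and r_le_1: "\<And>t. t \<ge> 0 \<Longrightarrow> r t \<le> 1"
    and r_tendsto: "(r \<longlongrightarrow> 0) at_top"
    and \<alpha>_pos: "\<alpha> > 0" and A_lower: "\<And>x. \<alpha> * (norm x)\<^sup>2 \<le> x \<bullet> A x"
    and A_upper: "\<And>x. x \<bullet> A x \<le> \<beta> * (norm x)\<^sup>2"
    and B_nonneg: "\<And>x. 0 \<le> x \<bullet> B x" and B_upper: "\<And>x. x \<bullet> B x \<le> \<gamma> * (norm x)\<^sup>2"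
    and \<gamma>_nonneg: "\<gamma> \<ge> 0"
    and g_le_e: "\<And>t. t \<ge> 0 \<Longrightarrow> (\<Sum>j\<in>{1..J}. (norm (g t j))\<^sup>2) \<le> L * (\<Sum>j\<in>{1..J}. (norm (e t j))\<^sup>2)"
    and L_nonneg: "L \<ge> 0"
begin

text \<open>\<open>C t\<close> is the empirical covariance as an operator, \<open>q t\<close> its quadratic form and \<open>S t\<close> its trace;
  \<open>D t\<close> is the cross covariance from the parameter space to the data space.\<close>
definition q :: "real \<Rightarrow> 'a \<Rightarrow> real" where
  "q t z = (1 / real J) * (\<Sum>j\<in>{1..J}. (z \<bullet> e t j)\<^sup>2)"

definition C :: "real \<Rightarrow> 'a \<Rightarrow> 'a" where
  "C t z = (1 / real J) *\<^sub>R (\<Sum>j\<in>{1..J}. (z \<bullet> e t j) *\<^sub>R e t j)"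

definition D :: "real \<Rightarrow> 'a \<Rightarrow> 'b" where
  "D t z = (1 / real J) *\<^sub>R (\<Sum>j\<in>{1..J}. (z \<bullet> e t j) *\<^sub>R g t j)"

definition S :: "real \<Rightarrow> real" where
  "S t = (1 / real J) * (\<Sum>j\<in>{1..J}. (norm (e t j))\<^sup>2)"

definition E :: "'a set" where
  "E = span (e 0 ` {1..J})"

lemma subspace_E: "subspace E"
  by (simp add: E_def)

lemma q_nonneg: "0 \<le> q t z"
  by (simp add: q_def sum_nonneg)

lemma S_nonneg: "0 \<le> S t"
  by (simp add: S_def sum_nonneg)

lemma inner_C: "x \<bullet> C t z = (1 / real J) * (\<Sum>j\<in>{1..J}. (x \<bullet> e t j) * (z \<bullet> e t j))"
  by (simp add: C_def inner_sum_right mult.commute)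

lemma inner_C_self: "z \<bullet> C t z = q t z"
  by (simp add: inner_C q_def power2_eq_square)

lemma C_symmetric: "x \<bullet> C t z = C t x \<bullet> z"
  by (simp add: inner_C inner_commute[of "C t x"] mult.commute)

lemma linear_C: "linear (C t)"
  by (rule linearI) (simp_all add: C_def inner_simps scaleR_left_distrib sum.distrib
      scaleR_right_distrib scaleR_sum_right algebra_simps)

lemma q_scaleR: "q t (c *\<^sub>R z) = c\<^sup>2 * q t z"
  by (simp add: q_def power_mult_distrib sum_distrib_left algebra_simps)

lemma q_eq_0_iff: "q t z = 0 \<longleftrightarrow> (\<forall>j\<in>{1..J}. z \<bullet> e t j = 0)"
  using J_pos by (simp add: q_def sum_nonneg_eq_0_iff)

lemma q_le_S: "q t z \<le> S t * (norm z)\<^sup>2"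
proof -
  have "(z \<bullet> e t j)\<^sup>2 \<le> (norm (e t j))\<^sup>2 * (norm z)\<^sup>2" for j
    using Cauchy_Schwarz_ineq[of z "e t j"] by (simp add: dot_square_norm mult.commute)
  then have "(\<Sum>j\<in>{1..J}. (z \<bullet> e t j)\<^sup>2) \<le> (\<Sum>j\<in>{1..J}. (norm (e t j))\<^sup>2) * (norm z)\<^sup>2"
    unfolding sum_distrib_right by (intro sum_mono)
  then show ?thesis
    using J_pos by (simp add: q_def S_def divide_right_mono)
qed

lemma S_eq_sum_q: "S t = (\<Sum>b\<in>Basis. q t b)"
proof -
  have "(norm x)\<^sup>2 = (\<Sum>b\<in>Basis. (b \<bullet> x)\<^sup>2)" for x :: 'a
    by (subst norm_conv_dist, subst euclidean_dist_l2)
      (simp add: L2_set_def sum_nonneg inner_commute)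
  then show ?thesis
    by (simp add: S_def q_def sum_distrib_left) (rule sum.swap)
qed

text \<open>The cross covariance is controlled by the covariance because \<open>g\<close> is controlled by \<open>e\<close>; this
  makes the first dissipation term at most proportional to \<open>S t * q t z\<close>.\<close>
lemma norm_D_le: "t \<ge> 0 \<Longrightarrow> (norm (D t z))\<^sup>2 \<le> L * S t * q t z"
proof -
  assume t: "t \<ge> 0"
  have "norm (\<Sum>j\<in>{1..J}. (z \<bullet> e t j) *\<^sub>R g t j) \<le> (\<Sum>j\<in>{1..J}. \<bar>z \<bullet> e t j\<bar> * norm (g t j))"
    by (rule order_trans[OF norm_sum]) simp
  then have "(norm (\<Sum>j\<in>{1..J}. (z \<bullet> e t j) *\<^sub>R g t j))\<^sup>2
      \<le> (\<Sum>j\<in>{1..J}. \<bar>z \<bullet> e t j\<bar> * norm (g t j))\<^sup>2"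
    by (intro power_mono) auto
  also have "\<dots> \<le> (\<Sum>j\<in>{1..J}. (z \<bullet> e t j)\<^sup>2) * (\<Sum>j\<in>{1..J}. (norm (g t j))\<^sup>2)"
    using Cauchy_Schwarz_ineq_sum[of "\<lambda>j. \<bar>z \<bullet> e t j\<bar>" "\<lambda>j. norm (g t j)"] by simp
  also have "\<dots> \<le> (\<Sum>j\<in>{1..J}. (z \<bullet> e t j)\<^sup>2) * (L * (\<Sum>j\<in>{1..J}. (norm (e t j))\<^sup>2))"
    by (intro mult_left_mono g_le_e t sum_nonneg) auto
  finally have "(norm (\<Sum>j\<in>{1..J}. (z \<bullet> e t j) *\<^sub>R g t j))\<^sup>2 / (real J)\<^sup>2
      \<le> (\<Sum>j\<in>{1..J}. (z \<bullet> e t j)\<^sup>2) * (L * (\<Sum>j\<in>{1..J}. (norm (e t j))\<^sup>2)) / (real J)\<^sup>2"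
    by (rule divide_right_mono) simp
  then show ?thesis
    by (simp add: D_def S_def q_def power_divide power2_eq_square algebra_simps)
qed

text \<open>Both dissipation terms are quadratic forms of \<open>A\<close> and \<open>B\<close>: summing over the particles turns the
  weights \<open>g t l \<bullet> B (g t j)\<close> and \<open>e t l \<bullet> A (e t j)\<close>, each paired with \<open>z \<bullet> e t l\<close> and
  \<open>z \<bullet> e t j\<close>, into \<open>D t z \<bullet> B (D t z)\<close> and \<open>C t z \<bullet> A (C t z)\<close>.\<close>
lemma q_has_derivative:
  assumes "t \<ge> 0"
  shows "((\<lambda>s. q s z) has_real_derivative
    - 2 * (r t * (D t z \<bullet> B (D t z)) + C t z \<bullet> A (C t z))) (at t within {0..})"
proof -
  interpret A: linear A by (rule linear_A)
  interpret B: linear B by (rule linear_B)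
  have e': "((\<lambda>s. z \<bullet> e s j) has_real_derivative
      - (r t * (D t z \<bullet> B (g t j)) + C t z \<bullet> A (e t j))) (at t within {0..})"
    if "j \<in> {1..J}" for j
  proof -
    have "((\<lambda>s. z \<bullet> e s j) has_vector_derivative
      z \<bullet> - ((1 / real J) *\<^sub>R (\<Sum>l\<in>{1..J}.
            (r t * (g t l \<bullet> B (g t j)) + e t l \<bullet> A (e t j)) *\<^sub>R e t l))) (at t within {0..})"
      by (rule bounded_linear.has_vector_derivative[OF bounded_linear_inner_right flow])
        (use assms that in auto)
    moreover have "z \<bullet> - ((1 / real J) *\<^sub>R (\<Sum>l\<in>{1..J}.
            (r t * (g t l \<bullet> B (g t j)) + e t l \<bullet> A (e t j)) *\<^sub>R e t l))
        = - (r t * (D t z \<bullet> B (g t j)) + C t z \<bullet> A (e t j))"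
      by (simp add: C_def D_def inner_sum_left inner_sum_right sum.distrib sum_distrib_left
          algebra_simps add_divide_distrib sum_divide_distrib)
    ultimately show ?thesis
      by (simp add: has_real_derivative_iff_has_vector_derivative)
  qed
  have "((\<lambda>s. q s z) has_real_derivative (1 / real J) * (\<Sum>j\<in>{1..J}.
      2 * (z \<bullet> e t j) * - (r t * (D t z \<bullet> B (g t j)) + C t z \<bullet> A (e t j)))) (at t within {0..})"
    unfolding q_def
    by (intro DERIV_cmult DERIV_sum) (auto intro!: derivative_eq_intros e')
  moreover have "(1 / real J) * (\<Sum>j\<in>{1..J}.
      2 * (z \<bullet> e t j) * - (r t * (D t z \<bullet> B (g t j)) + C t z \<bullet> A (e t j)))
    = - 2 * (r t * (D t z \<bullet> B (D t z)) + C t z \<bullet> A (C t z))"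
  proof -
    have "D t z \<bullet> B (D t z) = (1 / real J) * (\<Sum>j\<in>{1..J}. (z \<bullet> e t j) * (D t z \<bullet> B (g t j)))"
      by (subst (2) D_def) (simp add: B.scaleR B.sum inner_sum_right)
    moreover have "C t z \<bullet> A (C t z) = (1 / real J) * (\<Sum>j\<in>{1..J}. (z \<bullet> e t j) * (C t z \<bullet> A (e t j)))"
      by (subst (2) C_def) (simp add: A.scaleR A.sum inner_sum_right)
    ultimately show ?thesis
      by (simp add: sum.distrib sum_distrib_left algebra_simps sum_negf sum_subtractf)
  qed
  ultimately show ?thesis by simp
qed

lemma q_has_derivative_at:
  assumes "t > 0"
  shows "((\<lambda>s. q s z) has_real_derivative
    - 2 * (r t * (D t z \<bullet> B (D t z)) + C t z \<bullet> A (C t z))) (at t)"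
proof -
  have "at t within {0..} = at t"
    using assms by (intro at_within_interior) auto
  then show ?thesis
    using q_has_derivative[of t z] assms by simp
qed

lemma C_A_C_lower: "0 \<le> \<alpha> * (norm (C t z))\<^sup>2" "\<alpha> * (norm (C t z))\<^sup>2 \<le> C t z \<bullet> A (C t z)"
  using \<alpha>_pos A_lower by auto

lemma continuous_on_q: "continuous_on {0..} (\<lambda>t. q t z)"
  using q_has_derivative by (intro DERIV_continuous_on) auto

lemma continuous_on_e: "j \<in> {1..J} \<Longrightarrow> continuous_on {0..} (\<lambda>t. e t j)"
  using flow by (auto simp: continuous_on_eq_continuous_within
      intro!: has_vector_derivative_continuous)

lemma continuous_on_q2: "T \<ge> 0 \<Longrightarrow> continuous_on ({T..} \<times> K) (\<lambda>(t, z). q t z)"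
  unfolding q_def split_def
  by (intro continuous_intros continuous_on_compose2[OF continuous_on_e, where f = fst]) auto

lemma q_antimono:
  assumes "0 \<le> s" "s \<le> t"
  shows "q t z \<le> q s z"
proof (rule DERIV_nonpos_imp_decreasing_open[OF \<open>s \<le> t\<close>])
  fix x assume "s < x" "x < t"
  then have "x > 0" using assms by simp
  moreover have "- 2 * (r x * (D x z \<bullet> B (D x z)) + C x z \<bullet> A (C x z)) \<le> 0"
    using C_A_C_lower[of x z] mult_nonneg_nonneg[OF r_nonneg[of x] B_nonneg[of "D x z"]] \<open>x > 0\<close> by simp
  ultimately show "\<exists>y. ((\<lambda>t. q t z) has_real_derivative y) (at x) \<and> y \<le> 0"
    using q_has_derivative_at by blast
next
  show "continuous_on {s..t} (\<lambda>t. q t z)"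
    using assms by (intro continuous_on_subset[OF continuous_on_q]) auto
qed

lemma S_antimono: "0 \<le> s \<Longrightarrow> s \<le> t \<Longrightarrow> S t \<le> S s"
  unfolding S_eq_sum_q by (intro sum_mono q_antimono)

text \<open>Since \<open>q t z = z \<bullet> C t z \<le> norm (C t z)\<close> for a unit vector, \<open>q\<close> satisfies the Riccati
  inequality \<open>q' \<le> - 2 * \<alpha> * q\<^sup>2\<close>, that is, \<open>inverse q\<close> grows at least at speed \<open>2 * \<alpha>\<close>.\<close>
lemma q_decay:
  assumes "t > 0" "norm z = 1"
  shows "q t z \<le> 1 / (2 * \<alpha> * t)"
proof (cases "q t z > 0")
  case True
  define f where "f s = inverse (q s z) - 2 * \<alpha> * s" for s
  have pos: "q s z > 0" if "0 \<le> s" "s \<le> t" for s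
    using q_antimono[OF that] True by (rule less_le_trans[rotated])
  have "f 0 \<le> f t"
  proof (rule DERIV_nonneg_imp_increasing_open[of 0 t f])
    fix s assume s: "0 < s" "s < t"
    define d where "d = - 2 * (r s * (D s z \<bullet> B (D s z)) + C s z \<bullet> A (C s z))"
    have "(q s z)\<^sup>2 \<le> (norm (C s z))\<^sup>2"
      using Cauchy_Schwarz_ineq2[of z "C s z"] assms
      by (intro power_mono q_nonneg) (simp_all add: inner_C_self)
    then have "\<alpha> * (q s z)\<^sup>2 \<le> C s z \<bullet> A (C s z)"
      using C_A_C_lower(2)[of s z] \<alpha>_pos by (meson mult_left_mono order_trans less_imp_le)
    then have d: "d \<le> - 2 * \<alpha> * (q s z)\<^sup>2"
      using mult_nonneg_nonneg[OF r_nonneg[of s] B_nonneg[of "D s z"]] s by (simp add: d_def)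
    have "(f has_real_derivative - (inverse (q s z) * d * inverse (q s z)) - 2 * \<alpha>) (at s)"
      unfolding f_def d_def using pos[of s] s
      by (auto intro!: derivative_eq_intros q_has_derivative_at)
    moreover have "- (inverse (q s z) * d * inverse (q s z)) - 2 * \<alpha> \<ge> 0"
      using d pos[of s] s by (simp add: field_simps power2_eq_square)
    ultimately show "\<exists>y. (f has_real_derivative y) (at s) \<and> 0 \<le> y"
      by blast
  next
    show "continuous_on {0..t} f"
      unfolding f_def using pos
      by (intro continuous_intros continuous_on_subset[OF continuous_on_q]) force+
  qed (use assms in simp)
  then have "2 * \<alpha> * t \<le> inverse (q t z)"
    using pos[of 0] assms by (simp add: f_def) (smt (verit) inverse_positive_iff_positive)
  then show ?thesis
    using True \<alpha>_pos assms by (simp add: field_simps)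
next
  case False
  then show ?thesis
    using \<alpha>_pos assms by (smt (verit) divide_nonneg_pos mult_pos_pos)
qed

lemma S_decay:
  assumes "t > 0"
  shows "S t \<le> real DIM('a) / (2 * \<alpha> * t)"
proof -
  have "S t \<le> (\<Sum>b\<in>(Basis :: 'a set). 1 / (2 * \<alpha> * t))"
    unfolding S_eq_sum_q by (intro sum_mono q_decay assms) simp
  then show ?thesis by simp
qed

text \<open>The initial deviation span is invariant under the flow: for a normal vector \<open>n\<close> the variance
  \<open>q t n\<close> starts at zero, never increases and is nonnegative.\<close>
lemma inner_e_eq_0:
  assumes "\<And>x. x \<in> E \<Longrightarrow> n \<bullet> x = 0" "t \<ge> 0" "j \<in> {1..J}"
  shows "n \<bullet> e t j = 0"
proof -
  have "q 0 n = 0"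
    unfolding q_eq_0_iff using assms(1) by (auto simp: E_def intro: span_base)
  then have "q t n = 0"
    using q_antimono[of 0 t n] q_nonneg[of t n] assms by simp
  then show ?thesis
    using assms q_eq_0_iff by blast
qed

lemma e_in_E:
  assumes "t \<ge> 0" "j \<in> {1..J}"
  shows "e t j \<in> E"
proof -
  obtain y n where yn: "y \<in> E" "\<And>x. x \<in> E \<Longrightarrow> orthogonal n x" "e t j = y + n"
    using orthogonal_subspace_decomp_exists[of "e 0 ` {1..J}" "e t j"] unfolding E_def by metis
  have "n \<bullet> n = n \<bullet> e t j - n \<bullet> y"
    by (simp add: yn(3) inner_simps)
  also have "\<dots> = 0"
    using yn inner_e_eq_0[of n t j] assms by (simp add: orthogonal_def)
  finally show ?thesis
    using yn by simp
qed

lemma C_in_E: "t \<ge> 0 \<Longrightarrow> C t z \<in> E"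
  unfolding C_def using subspace_E e_in_E
  by (intro subspace_scale subspace_sum) auto

lemma q_initial_pos:
  assumes "x \<in> E" "x \<noteq> 0"
  shows "q 0 x > 0"
proof (rule ccontr)
  assume "\<not> q 0 x > 0"
  then have "q 0 x = 0"
    using q_nonneg[of 0 x] by simp
  then have "orthogonal x y" if "y \<in> e 0 ` {1..J}" for y
    using that by (auto simp: q_eq_0_iff orthogonal_def)
  then have "orthogonal x x"
    using assms unfolding E_def by (intro orthogonal_to_span[of x "e 0 ` {1..J}" x]) auto
  then show False
    using assms by (simp add: orthogonal_def)
qed

text \<open>On the unit sphere \<open>K\<close> of the span, the minimum over \<open>z\<close> of \<open>q t z\<close> is the smallest eigenvalue of
  the covariance restricted to the span.\<close>
definition K :: "'a set" where
  "K = E \<inter> sphere 0 1"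

lemma compact_K: "compact K"
  unfolding K_def by (intro closed_Int_compact closed_subspace subspace_E compact_sphere)

lemma q_bounded_below_on_K:
  assumes "\<And>z. z \<in> K \<Longrightarrow> q t z > 0"
  obtains k where "k > 0" "\<And>z. z \<in> K \<Longrightarrow> k < q t z"
proof (cases "K = {}")
  case True
  then show ?thesis using that[of 1] by simp
next
  case False
  have "continuous_on K (q t)"
    unfolding q_def by (intro continuous_intros)
  then obtain z where "z \<in> K" "\<And>x. x \<in> K \<Longrightarrow> q t z \<le> q t x"
    using continuous_attains_inf[OF compact_K False] by blast
  with assms show ?thesis
    by (intro that[of "q t z / 2"]) force+
qed

text \<open>For a general unit vector, \<open>norm (C t z)\<close> cannot be bounded in terms of \<open>q t z\<close> to the needed
  second order. At a minimizer it can: \<open>z\<close> is then an eigenvector of \<open>C t\<close>, which maps into \<open>E\<close>, so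
  \<open>norm (C t z) = q t z\<close>.\<close>
lemma derivative_at_minimizer:
  assumes t: "t > 0" and z: "z \<in> K" and min: "\<And>x. x \<in> K \<Longrightarrow> q t z \<le> q t x"
  obtains d where "((\<lambda>s. q s z) has_real_derivative d) (at t)"
    "d \<ge> - 2 * q t z * (r t * \<gamma> * L * S t + \<beta> * q t z)"
proof
  show "((\<lambda>s. q s z) has_real_derivative
    - 2 * (r t * (D t z \<bullet> B (D t z)) + C t z \<bullet> A (C t z))) (at t)"
    by (rule q_has_derivative_at[OF t])
  have "C t z = (z \<bullet> C t z) *\<^sub>R z"
    by (rule Rayleigh_minimizer_is_eigenvector[OF linear_C _ subspace_E])
      (use z min t in \<open>auto simp: C_in_E K_def inner_C_self intro: C_symmetric\<close>)
  then have Cz: "C t z = q t z *\<^sub>R z"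
    by (simp add: inner_C_self)
  interpret A: linear A by (rule linear_A)
  have "C t z \<bullet> A (C t z) = (q t z)\<^sup>2 * (z \<bullet> A z)"
    by (simp add: Cz A.scaleR power2_eq_square)
  also have "\<dots> \<le> (q t z)\<^sup>2 * \<beta>"
    using A_upper[of z] z by (intro mult_left_mono) (auto simp: K_def)
  finally have 1: "C t z \<bullet> A (C t z) \<le> q t z * (\<beta> * q t z)"
    by (simp add: power2_eq_square algebra_simps)
  have "D t z \<bullet> B (D t z) \<le> \<gamma> * (L * S t * q t z)"
    using B_upper[of "D t z"] norm_D_le[of t z] t \<gamma>_nonneg
    by (meson mult_left_mono order_trans less_imp_le)
  then have "r t * (D t z \<bullet> B (D t z)) \<le> r t * (\<gamma> * (L * S t * q t z))"
    using r_nonneg t by (intro mult_left_mono) auto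
  with 1 show "- 2 * q t z * (r t * \<gamma> * L * S t + \<beta> * q t z)
      \<le> - 2 * (r t * (D t z \<bullet> B (D t z)) + C t z \<bullet> A (C t z))"
    by (simp add: algebra_simps)
qed

lemma \<beta>_nonneg: "\<beta> \<ge> 0"
  using A_lower[of "SOME b. b \<in> Basis"] A_upper[of "SOME b. b \<in> Basis"] \<alpha>_pos
  by (simp add: SOME_Basis)

text \<open>At a minimizer the relative rate of decay of \<open>q\<close> is
  bounded by a constant, as \<open>S\<close> never exceeds its initial value. The barrier principle is applied
  to \<open>exp (M * t) * q t z\<close> with \<open>M\<close> larger than that constant.\<close>
lemma q_pos_on_K:
  assumes "t \<ge> 0" "z \<in> K"
  shows "q t z > 0"
proof -
  obtain k where k: "k > 0" "\<And>z. z \<in> K \<Longrightarrow> k < q 0 z"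
  proof (rule q_bounded_below_on_K[of 0])
    show "q 0 z > 0" if "z \<in> K" for z
      using that by (intro q_initial_pos) (auto simp: K_def)
  qed blast
  \<comment> \<open>One more than a bound on the relative decay rate at a minimizer, so that
    the derivative is strictly positive.\<close>
  define M where "M = 2 * (\<gamma> * L + \<beta>) * S 0 + 1"
  have "exp (M * t) * q t z > k"
  proof (rule parametric_barrier[OF _ compact_K, of 0 "\<lambda>t z. exp (M * t) * q t z"])
    show "continuous_on ({0..} \<times> K) (\<lambda>(t, z). exp (M * t) * q t z)"
      using continuous_on_q2[of 0 K] by (auto simp: split_def intro!: continuous_intros)
    show "k < exp (M * 0) * q 0 z" if "z \<in> K" for z
      using k that by simp
    fix t z
    assume t: "t > 0" and z: "z \<in> K" and eq: "exp (M * t) * q t z = k"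
      and min: "\<And>x. x \<in> K \<Longrightarrow> k \<le> exp (M * t) * q t x"
    have "q t z > 0"
      using k eq by (metis exp_gt_zero zero_less_mult_pos)
    have "q t z \<le> q t x" if "x \<in> K" for x
      using min[OF that] unfolding eq[symmetric] by simp
    then obtain d where d: "((\<lambda>s. q s z) has_real_derivative d) (at t)"
        "d \<ge> - 2 * q t z * (r t * \<gamma> * L * S t + \<beta> * q t z)"
      using derivative_at_minimizer[OF t z] by blast
    have "r t * (\<gamma> * L * S t) \<le> 1 * (\<gamma> * L * S 0)"
      using r_nonneg r_le_1 t \<gamma>_nonneg L_nonneg S_antimono[of 0 t] S_nonneg
      by (intro mult_mono) auto
    moreover have "q t z \<le> S 0"
      using q_le_S[of t z] S_antimono[of 0 t] z t by (simp add: K_def)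
    then have "\<beta> * q t z \<le> \<beta> * S 0"
      using \<beta>_nonneg by (rule mult_left_mono)
    ultimately have "2 * (r t * \<gamma> * L * S t + \<beta> * q t z) < M"
      by (simp add: M_def algebra_simps)
    then have "q t z * (2 * (r t * \<gamma> * L * S t + \<beta> * q t z)) < q t z * M"
      using \<open>q t z > 0\<close> by (rule mult_strict_left_mono)
    with d(2) have "0 < M * q t z + d"
      by (simp add: algebra_simps)
    then have pos: "0 < exp (M * t) * (M * q t z + d)"
      by simp
    have "((\<lambda>s. exp (M * s) * q s z) has_real_derivative exp (M * t) * (M * q t z + d)) (at t)"
      by (auto intro!: derivative_eq_intros d(1) simp: algebra_simps)
    with pos show "\<exists>D>0. ((\<lambda>s. exp (M * s) * q s z) has_real_derivative D) (at t)"
      by blast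
  qed (use assms in auto)
  with k show ?thesis
    by (smt (verit) exp_gt_zero zero_less_mult_pos)
qed

text \<open>The barrier principle applied to \<open>t * q t z\<close>. At a minimizer with \<open>t * q t z = \<kappa>\<close> its derivative is
  at least \<open>q t z * (1 - 2 * r t * \<gamma> * L * (t * S t) - 2 * \<beta> * \<kappa>)\<close>. The trace decays at least like
  \<open>1 / t\<close>, so \<open>t * S t\<close> is bounded by \<open>\<sigma>\<close>; as \<open>r\<close> tends to zero, the first correction is small at
  late times, and the second is small once \<open>\<kappa>\<close> is.\<close>
lemma q_lower_on_K:
  obtains T \<kappa> where "T > 0" "\<kappa> > 0" "\<And>t z. t \<ge> T \<Longrightarrow> z \<in> K \<Longrightarrow> q t z > \<kappa> / t"
proof -
  define \<sigma> where "\<sigma> = real DIM('a) / (2 * \<alpha>)"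
  have "((\<lambda>t. r t * (2 * \<gamma> * L * \<sigma>)) \<longlongrightarrow> 0 * (2 * \<gamma> * L * \<sigma>)) at_top"
    by (intro tendsto_intros r_tendsto)
  then have "\<forall>\<^sub>F t in at_top. r t * (2 * \<gamma> * L * \<sigma>) < 1 / 4"
    by (rule order_tendstoD) simp
  then obtain T0 where T0: "\<And>t. t \<ge> T0 \<Longrightarrow> r t * (2 * \<gamma> * L * \<sigma>) < 1 / 4"
    by (auto simp: eventually_at_top_linorder)
  define T where "T = max T0 1"
  have T: "T > 0" by (simp add: T_def)
  obtain k where k: "k > 0" "\<And>z. z \<in> K \<Longrightarrow> k < q T z"
    using q_bounded_below_on_K[of T] q_pos_on_K[of T] T by auto
  define \<kappa> where "\<kappa> = min (T * k) (1 / (8 * (\<beta> + 1)))"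
  have \<kappa>: "\<kappa> > 0"
    using T k \<beta>_nonneg by (simp add: \<kappa>_def)
  have \<kappa>_\<beta>: "2 * \<beta> * \<kappa> \<le> 1 / 4"
  proof -
    have "2 * \<beta> * \<kappa> \<le> 2 * \<beta> * (1 / (8 * (\<beta> + 1)))"
      using \<beta>_nonneg by (intro mult_left_mono) (auto simp: \<kappa>_def)
    also have "\<dots> \<le> 1 / 4"
      using \<beta>_nonneg by (simp add: field_simps)
    finally show ?thesis .
  qed
  have "t * q t z > \<kappa>" if "t \<ge> T" "z \<in> K" for t z
  proof (rule parametric_barrier[OF _ compact_K, of T "\<lambda>t z. t * q t z"])
    show "continuous_on ({T..} \<times> K) (\<lambda>(t, z). t * q t z)"
      using continuous_on_q2[of T K] T by (auto simp: split_def intro!: continuous_intros)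
    show "\<kappa> < T * q T z" if "z \<in> K" for z
    proof -
      have "\<kappa> \<le> T * k" by (simp add: \<kappa>_def)
      also have "\<dots> < T * q T z" using k(2)[OF that] T by simp
      finally show ?thesis .
    qed
    fix t z
    assume t: "t > T" and z: "z \<in> K" and eq: "t * q t z = \<kappa>"
      and min: "\<And>x. x \<in> K \<Longrightarrow> \<kappa> \<le> t * q t x"
    have t0: "t > 0" using t T by simp
    have "q t z > 0"
      using q_pos_on_K[of t z] z t0 by simp
    have "q t z \<le> q t x" if "x \<in> K" for x
      using min[OF that] t0 unfolding eq[symmetric] by simp
    then obtain d where d: "((\<lambda>s. q s z) has_real_derivative d) (at t)"
        "d \<ge> - 2 * q t z * (r t * \<gamma> * L * S t + \<beta> * q t z)"
      using derivative_at_minimizer[OF t0 z] by blast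
    have "t * S t \<le> \<sigma>"
      using S_decay[OF t0] t0 \<alpha>_pos by (simp add: \<sigma>_def field_simps)
    then have "r t * (2 * \<gamma> * L) * (t * S t) \<le> r t * (2 * \<gamma> * L) * \<sigma>"
      using r_nonneg[of t] t0 \<gamma>_nonneg L_nonneg by (intro mult_left_mono) auto
    also have "\<dots> < 1 / 4"
      using T0[of t] t by (simp add: T_def algebra_simps)
    finally have "2 * t * (r t * \<gamma> * L * S t + \<beta> * q t z) < 1"
      using \<kappa>_\<beta> unfolding eq[symmetric] by (simp add: algebra_simps)
    then have "q t z * (2 * t * (r t * \<gamma> * L * S t + \<beta> * q t z)) < q t z * 1"
      using \<open>q t z > 0\<close> by (rule mult_strict_left_mono)
    moreover have "t * d \<ge> t * (- 2 * q t z * (r t * \<gamma> * L * S t + \<beta> * q t z))"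
      using d(2) t0 by (intro mult_left_mono) auto
    ultimately have pos: "0 < q t z + t * d"
      by (simp add: algebra_simps)
    have "((\<lambda>s. s * q s z) has_real_derivative q t z + t * d) (at t)"
      by (auto intro!: derivative_eq_intros d(1) simp: algebra_simps)
    with pos show "\<exists>D>0. ((\<lambda>s. s * q s z) has_real_derivative D) (at t)"
      by blast
  qed (use that in auto)
  then have "q t z > \<kappa> / t" if "t \<ge> T" "z \<in> K" for t z
    using that T by (simp add: field_simps)
  then show ?thesis
    using that T \<kappa> by blast
qed

lemma q_lower_on_E:
  obtains T \<kappa> where "T > 0" "\<kappa> > 0"
    "\<And>t x. t \<ge> T \<Longrightarrow> x \<in> E \<Longrightarrow> q t x \<ge> \<kappa> * (norm x)\<^sup>2 / t"
proof -
  obtain T \<kappa> where T: "T > 0" "\<kappa> > 0" "\<And>t z. t \<ge> T \<Longrightarrow> z \<in> K \<Longrightarrow> q t z > \<kappa> / t"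
    using q_lower_on_K by blast
  have "q t x \<ge> \<kappa> * (norm x)\<^sup>2 / t" if "t \<ge> T" "x \<in> E" for t x
  proof (cases "x = 0")
    case False
    define z where "z = x /\<^sub>R norm x"
    have "z \<in> K"
      using that False subspace_E by (simp add: K_def z_def subspace_scale)
    moreover have "q t x = (norm x)\<^sup>2 * q t z"
      using False q_scaleR[of t "norm x" z] by (simp add: z_def)
    ultimately show ?thesis
      using mult_left_mono[OF less_imp_le[OF T(3)[OF that(1), of z]], of "(norm x)\<^sup>2"]
      by (simp add: mult.commute)
  qed (simp add: q_nonneg)
  with T show ?thesis
    using that by blast
qed

end

section \<open>Spectra of symmetric positive definite matrices\<close>

lemma sym_pos_def_inner_symmetric:
  assumes "sym_pos_def M"
  shows "x \<bullet> (M *v y) = (M *v x) \<bullet> y"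
proof -
  have "transpose M = M"
    using assms by (simp add: sym_pos_def_def)
  then show ?thesis
    by (metis dot_lmul_matrix transpose_matrix_vector)
qed

lemma sym_pos_def_matrix_inv:
  assumes "sym_pos_def M"
  shows "sym_pos_def (matrix_inv M)"
proof -
  have ker: "x = 0" if "M *v x = 0" for x
    using assms that by (metis inner_zero_right less_irrefl sym_pos_def_def)
  have "invertible M"
    unfolding invertible_left_inverse matrix_left_invertible_ker using ker by blast
  then have MN: "M ** matrix_inv M = mat 1"
    unfolding invertible_def matrix_inv_def by (metis (mono_tags, lifting) someI_ex)
  have inv: "M *v (matrix_inv M *v x) = x" for x
    by (simp add: matrix_vector_mul_assoc MN)
  have "transpose (matrix_inv M) = matrix_inv M"
  proof -
    have "x \<bullet> (matrix_inv M *v y) = (matrix_inv M *v x) \<bullet> y" for x y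
      using sym_pos_def_inner_symmetric[OF assms, of "matrix_inv M *v x" "matrix_inv M *v y"]
      by (simp add: inv)
    then have "(transpose (matrix_inv M) *v y - matrix_inv M *v y) \<bullet> x = 0" for x y
      by (simp add: inner_diff_left inner_diff_right dot_lmul_matrix transpose_matrix_vector
          inner_commute[of "matrix_inv M *v y" x])
    then show ?thesis
      by (metis eq_iff_diff_eq_0 inner_eq_zero_iff matrix_eq)
  qed
  moreover have "x \<bullet> (matrix_inv M *v x) > 0" if "x \<noteq> 0" for x
  proof -
    have "matrix_inv M *v x \<noteq> 0"
      using inv[of x] that by force
    then have "(matrix_inv M *v x) \<bullet> (M *v (matrix_inv M *v x)) > 0"
      using assms by (auto simp: sym_pos_def_def)
    then show ?thesis
      by (simp add: inv inner_commute)
  qed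
  ultimately show ?thesis
    by (simp add: sym_pos_def_def)
qed

text \<open>The minimum of the quadratic form on the unit sphere yields at the same time an eigenvalue
  and a coercivity constant.\<close>
lemma sym_pos_def_Rayleigh_minimizer:
  fixes M :: "real^'n^'n"
  assumes "sym_pos_def M"
  obtains z where "norm z = 1" "M *v z = (z \<bullet> (M *v z)) *\<^sub>R z" "z \<bullet> (M *v z) > 0"
    "\<And>x. (z \<bullet> (M *v z)) * (norm x)\<^sup>2 \<le> x \<bullet> (M *v x)"
proof -
  have "continuous_on (sphere 0 1) (\<lambda>x. x \<bullet> (M *v x))"
    by (intro continuous_intros)
  then obtain z where z: "norm z = 1" "\<And>x. norm x = 1 \<Longrightarrow> z \<bullet> (M *v z) \<le> x \<bullet> (M *v x)"
    using continuous_attains_inf[OF compact_sphere, of 0 1 "\<lambda>x. x \<bullet> (M *v x)"] by auto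
  have "z \<noteq> 0"
    using z(1) by auto
  then have "z \<bullet> (M *v z) > 0"
    using assms by (simp add: sym_pos_def_def)
  moreover have "M *v z = (z \<bullet> (M *v z)) *\<^sub>R z"
    by (rule Rayleigh_minimizer_is_eigenvector[of _ UNIV])
      (use z in \<open>auto intro: sym_pos_def_inner_symmetric[OF assms]\<close>)
  moreover have "(z \<bullet> (M *v z)) * (norm x)\<^sup>2 \<le> x \<bullet> (M *v x)" for x
  proof (cases "x = 0")
    case False
    then have "z \<bullet> (M *v z) \<le> (x /\<^sub>R norm x) \<bullet> (M *v (x /\<^sub>R norm x))"
      by (intro z) simp
    also have "\<dots> = (x \<bullet> (M *v x)) / (norm x)\<^sup>2"
      by (simp add: matrix_vector_mult_scaleR power2_eq_square divide_simps)
    finally show ?thesis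
      using False by (simp add: pos_le_divide_eq)
  qed simp
  ultimately show ?thesis
    using that z(1) by blast
qed

lemma sym_pos_def_bounds:
  fixes M :: "real^'n^'n"
  assumes "sym_pos_def M"
  obtains \<alpha> \<beta> where "\<alpha> > 0" "\<beta> > 0" "\<And>x. \<alpha> * (norm x)\<^sup>2 \<le> x \<bullet> (M *v x)"
    "\<And>x. x \<bullet> (M *v x) \<le> \<beta> * (norm x)\<^sup>2"
proof -
  obtain \<beta> where \<beta>: "\<beta> > 0" "\<And>x. norm (M *v x) \<le> \<beta> * norm x"
    using linear_bounded_pos[OF matrix_vector_mul_linear, of M] by blast
  have "x \<bullet> (M *v x) \<le> \<beta> * (norm x)\<^sup>2" for x
  proof -
    have "x \<bullet> (M *v x) \<le> norm x * norm (M *v x)"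
      by (rule norm_cauchy_schwarz)
    also have "\<dots> \<le> norm x * (\<beta> * norm x)"
      by (intro mult_left_mono \<beta>) simp
    finally show ?thesis
      by (simp add: power2_eq_square algebra_simps)
  qed
  with \<beta>(1) that show ?thesis
    using sym_pos_def_Rayleigh_minimizer[OF assms] by metis
qed

text \<open>Finiteness holds because eigenvectors of distinct eigenvalues are orthogonal, hence linearly
  independent. Together with nonemptiness it makes the minimum and maximum of the set of
  eigenvalues genuine eigenvalues, so that they are positive.\<close>
lemma sym_pos_def_eigenvalues:
  fixes M :: "real^'n^'n"
  assumes "sym_pos_def M"
  shows "finite (eigenvalues M)" "eigenvalues M \<noteq> {}" "\<And>l. l \<in> eigenvalues M \<Longrightarrow> l > 0"
proof -
  define v where "v l = (SOME x. x \<noteq> 0 \<and> M *v x = l *\<^sub>R x)" for l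
  have v: "v l \<noteq> 0" "M *v v l = l *\<^sub>R v l" if "l \<in> eigenvalues M" for l
    using someI_ex[of "\<lambda>x. x \<noteq> 0 \<and> M *v x = l *\<^sub>R x"] that
    by (auto simp: v_def eigenvalues_def)
  have orth: "v k \<bullet> v l = 0" if "k \<in> eigenvalues M" "l \<in> eigenvalues M" "k \<noteq> l" for k l
    using sym_pos_def_inner_symmetric[OF assms, of "v k" "v l"] v that by simp
  have inj: "inj_on v (eigenvalues M)"
    using orth v by (intro inj_onI) (metis inner_eq_zero_iff)
  have "independent (v ` eigenvalues M)"
    using orth v by (intro pairwise_orthogonal_independent)
      (auto simp: pairwise_def orthogonal_def)
  then show "finite (eigenvalues M)"
    using inj finite_imageD independent_imp_finite by blast
  obtain z where z: "norm z = 1" "M *v z = (z \<bullet> (M *v z)) *\<^sub>R z"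
    using sym_pos_def_Rayleigh_minimizer[OF assms] by metis
  then have "z \<bullet> (M *v z) \<in> eigenvalues M"
    unfolding eigenvalues_def mem_Collect_eq by (intro exI[of _ z]) auto
  then show "eigenvalues M \<noteq> {}" by blast
  show "l > 0" if "l \<in> eigenvalues M" for l
  proof -
    have "v l \<bullet> (M *v v l) > 0"
      using assms v(1)[OF that] by (simp add: sym_pos_def_def)
    moreover have "v l \<bullet> (M *v v l) = l * (v l \<bullet> v l)"
      using v(2)[OF that] by simp
    ultimately show ?thesis
      using inner_ge_zero[of "v l"] by (simp add: zero_less_mult_iff not_less[symmetric])
  qed
qed

section \<open>The inflated constrained EKI flow as a deviation flow\<close>

text \<open>Along the segment from \<open>x\<close> to \<open>y\<close> the local estimates add up, since the lengths of consecutive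
  pieces do.\<close>
lemma dist_le_of_locally_lipschitz_const:
  fixes f :: "'a::real_normed_vector \<Rightarrow> 'b::metric_space"
  assumes "locally_lipschitz_const c f"
  shows "dist (f x) (f y) \<le> c * dist x y"
proof -
  define p where "p s = x + s *\<^sub>R (y - x)" for s :: real
  have pd: "dist (p s) (p t) = \<bar>t - s\<bar> * dist x y" for s t
  proof -
    have "p s - p t = (t - s) *\<^sub>R (x - y)"
      by (simp add: p_def algebra_simps)
    then show ?thesis by (simp add: dist_norm)
  qed
  have "(0::real) \<le> 1" by simp
  then have "dist (f (p 0)) (f (p 1)) \<le> c * ((1 - 0) * dist x y)"
  proof (induction rule: Bolzano[where P = "\<lambda>s t. dist (f (p s)) (f (p t)) \<le> c * ((t - s) * dist x y)"])
    case (trans a b c')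
    then show ?case
      using dist_triangle[of "f (p a)" "f (p c')" "f (p b)"] by (simp add: algebra_simps)
  next
    case (local s)
    obtain U where U: "open U" "p s \<in> U" "c-lipschitz_on U f"
      using assms unfolding locally_lipschitz_const_def by metis
    have "isCont p s"
      unfolding p_def by (intro continuous_intros)
    then have "\<forall>\<^sub>F t in nhds s. p t \<in> U"
      using U(1,2) by (simp add: continuous_at_open eventually_nhds)
    then obtain d where d: "d > 0" "\<And>t. dist t s < d \<Longrightarrow> p t \<in> U"
      unfolding eventually_nhds_metric by blast
    have "dist (f (p a)) (f (p b)) \<le> c * ((b - a) * dist x y)"
      if "a \<le> s \<and> s \<le> b \<and> b - a < d" for a b
    proof -
      have "p a \<in> U" "p b \<in> U"
        using that by (auto intro!: d simp: dist_real_def)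
      then have "dist (f (p a)) (f (p b)) \<le> c * dist (p a) (p b)"
        using lipschitz_onD[OF U(3)] by blast
      then show ?thesis
        using that by (simp add: pd)
    qed
    then show ?case
      using d(1) by blast
  qed
  then show ?thesis by (simp add: p_def)
qed

lemma sum_deviations_eq_0: "J > 0 \<Longrightarrow> (\<Sum>j\<in>{1..J}. v j - mean J v) = 0"
  by (simp add: sum_subtractf mean_def sum_constant_scaleR)

lemma mean_linear: "linear f \<Longrightarrow> mean J (\<lambda>j. f (v j)) = f (mean J v)"
  by (simp add: mean_def linear_cmul linear_sum)

lemma mean_add: "mean J (\<lambda>j. v j + w j) = mean J v + mean J w"
  by (simp add: mean_def sum.distrib scaleR_add_right)

lemma mean_diff: "mean J (\<lambda>j. v j - w j) = mean J v - mean J w"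
  by (simp add: mean_def sum_subtractf scaleR_diff_right)

lemma mean_const: "J > 0 \<Longrightarrow> mean J (\<lambda>j. c) = c"
  by (simp add: mean_def sum_constant_scaleR)

text \<open>Expanding the squares about the mean, the mixed terms cancel in the sum.\<close>
lemma sum_norm_deviations_le:
  fixes v :: "nat \<Rightarrow> 'a::real_inner"
  assumes "J > 0"
  shows "(\<Sum>j\<in>{1..J}. (norm (v j - mean J v))\<^sup>2) \<le> (\<Sum>j\<in>{1..J}. (norm (v j - p))\<^sup>2)"
proof -
  let ?m = "mean J v"
  have "(norm (v j - p))\<^sup>2 = (norm (v j - ?m))\<^sup>2 + 2 * ((v j - ?m) \<bullet> (?m - p)) + (norm (?m - p))\<^sup>2"
    for j
    by (simp add: power2_norm_eq_inner inner_simps inner_commute)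
  then have "(\<Sum>j\<in>{1..J}. (norm (v j - p))\<^sup>2) = (\<Sum>j\<in>{1..J}. (norm (v j - ?m))\<^sup>2)
      + 2 * ((\<Sum>j\<in>{1..J}. v j - ?m) \<bullet> (?m - p)) + real J * (norm (?m - p))\<^sup>2"
    by (simp add: sum.distrib sum_distrib_left inner_sum_left)
  then show ?thesis
    using assms by (simp only: sum_deviations_eq_0) simp
qed

lemma outer_mult_vector: "outer v w *v x = (w \<bullet> x) *\<^sub>R v"
  by (simp add: outer_def matrix_vector_mult_def inner_vec_def vec_eq_iff sum_distrib_left
      sum_distrib_right algebra_simps)

lemma sum_matrix_mult_vector: "(\<Sum>i\<in>I. M i) *v x = (\<Sum>i\<in>I. (M i :: real^'n^'m) *v x)"
  by (induction I rule: infinite_finite_induct) (simp_all add: matrix_vector_mult_add_rdistrib)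

lemma cross_cov_mult_vector:
  "cross_cov J v w *v x =
    (1 / real J) *\<^sub>R (\<Sum>j\<in>{1..J}. ((w j - mean J w) \<bullet> x) *\<^sub>R (v j - mean J v))"
  by (simp add: cross_cov_def scaleR_matrix_vector_assoc[symmetric] sum_matrix_mult_vector outer_mult_vector)

lemma inner_cov_mult_vector:
  "z \<bullet> (cov J v *v z) = (1 / real J) * (\<Sum>j\<in>{1..J}. (z \<bullet> (v j - mean J v))\<^sup>2)"
  by (simp add: cross_cov_mult_vector inner_sum_right power2_eq_square inner_commute)

text \<open>The data \<open>y\<close> and the penalty gradient contribute the same vector to all particles and disappear
  from the deviations; the two terms with the cross covariance combine to the factor \<open>1 - r\<close>.\<close>
lemma eki_rhs_deviation:
  assumes "J > 0"
  shows "eki_rhs J G y \<Gamma> C0 m h dh \<tau> r v j - mean J (eki_rhs J G y \<Gamma> C0 m h dh \<tau> r v) =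
    - ((1 / real J) *\<^sub>R (\<Sum>l\<in>{1..J}.
        ((1 - r) * ((G (v l) - mean J (\<lambda>l. G (v l))) \<bullet> (matrix_inv \<Gamma> *v (G (v j) - mean J (\<lambda>l. G (v l)))))
          + (v l - mean J v) \<bullet> (matrix_inv C0 *v (v j - mean J v))) *\<^sub>R (v l - mean J v)))"
proof -
  define H where "H = mean J (\<lambda>l. G (v l))"
  define P where "P x = cross_cov J v (\<lambda>l. G (v l)) *v (matrix_inv \<Gamma> *v x)" for x
  define Q where "Q x = cov J v *v (matrix_inv C0 *v x)" for x
  have P: "linear P" and Q: "linear Q"
    unfolding P_def Q_def by (simp_all add: linear_iff algebra_simps)
  define k where "k = (1 / \<tau>) *\<^sub>R (cov J v *v
             (\<Sum>i\<in>{1..m}. (1 / h i (mean J v)) *\<^sub>R dh i (mean J v)))"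
  have rhs: "eki_rhs J G y \<Gamma> C0 m h dh \<tau> r v =
      (\<lambda>j. - P (G (v j) - y) - Q (v j) + r *\<^sub>R P (G (v j) - H) + k)"
    by (rule ext) (simp add: eki_rhs_def P_def Q_def k_def H_def)
  have "linear (\<lambda>x. - P x)" "linear (\<lambda>x. r *\<^sub>R P x)"
    using P by (auto simp: linear_iff algebra_simps)
  then have m: "mean J (eki_rhs J G y \<Gamma> C0 m h dh \<tau> r v) = - P (H - y) - Q (mean J v) + r *\<^sub>R P 0 + k"
    using assms unfolding rhs
    by (simp add: mean_add mean_diff mean_const mean_linear[where f = "\<lambda>x. - P x"]
        mean_linear[where f = "\<lambda>x. r *\<^sub>R P x"] mean_linear[OF Q] H_def)
  have "eki_rhs J G y \<Gamma> C0 m h dh \<tau> r v j - mean J (eki_rhs J G y \<Gamma> C0 m h dh \<tau> r v) =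
      - ((1 - r) *\<^sub>R P (G (v j) - H) + Q (v j - mean J v))"
    unfolding m unfolding rhs
    by (simp add: linear_diff[OF P] linear_diff[OF Q] linear_0[OF P] algebra_simps)
  also have "(1 - r) *\<^sub>R P (G (v j) - H) + Q (v j - mean J v) =
      (1 / real J) *\<^sub>R (\<Sum>l\<in>{1..J}.
        ((1 - r) * ((G (v l) - H) \<bullet> (matrix_inv \<Gamma> *v (G (v j) - H)))
          + (v l - mean J v) \<bullet> (matrix_inv C0 *v (v j - mean J v))) *\<^sub>R (v l - mean J v))"
    unfolding P_def Q_def cross_cov_mult_vector H_def[symmetric] scaleR_add_left sum.distrib
      scaleR_add_right scaleR_scaleR[symmetric] scaleR_sum_right[symmetric]
    by (simp only: scaleR_left_commute)
  finally show ?thesis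
    unfolding H_def .
qed

lemma orth_proj_orthogonal:
  fixes x :: "'a::euclidean_space"
  assumes "subspace F"
  shows "\<And>w. w \<in> F \<Longrightarrow> (x - orth_proj F x) \<bullet> w = 0"
proof -
  have F: "span F = F"
    using assms by (rule span_eq_iff[THEN iffD2])
  obtain p n where pn: "p \<in> F" "\<And>w. w \<in> F \<Longrightarrow> orthogonal n w" "x = p + n"
    by (rule orthogonal_subspace_decomp_exists[of F x, unfolded F]) blast
  have "orth_proj F x = p"
    unfolding orth_proj_def
  proof (rule the_equality)
    show "p \<in> F \<and> (\<forall>e\<in>F. (x - p) \<bullet> e = 0)"
      using pn by (simp add: orthogonal_def)
    fix p'
    assume p': "p' \<in> F \<and> (\<forall>e\<in>F. (x - p') \<bullet> e = 0)"
    have "p - p' \<in> F"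
      using p' pn(1) assms by (simp add: subspace_diff)
    then have "(x - p') \<bullet> (p - p') = 0" "n \<bullet> (p - p') = 0"
      using p' pn(2) by (auto simp: orthogonal_def)
    then have "(p - p') \<bullet> (p - p') = 0"
      by (simp add: pn(3) inner_simps)
    then show "p' = p" by simp
  qed
  then show "(x - orth_proj F x) \<bullet> w = 0" if "w \<in> F" for w
    using pn(2)[OF that] \<open>orth_proj F x = p\<close> by (simp add: pn(3) orthogonal_def)
qed

text \<open>The offset of the affine space is orthogonal to its direction space, so Pythagoras applies to the
  decomposition of its elements.\<close>
lemma ensemble_affine_decompose:
  fixes v :: "nat \<Rightarrow> 'a::euclidean_space"
  obtains p where "\<And>w. w \<in> deviation_span J v \<Longrightarrow> p \<bullet> w = 0"
    "ensemble_affine J v = (\<lambda>e. p + e) ` deviation_span J v"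
proof (rule that)
  show "(mean J v - orth_proj (deviation_span J v) (mean J v)) \<bullet> w = 0"
    if "w \<in> deviation_span J v" for w
    using that by (intro orth_proj_orthogonal) (simp_all add: deviation_span_def)
qed (rule ensemble_affine_def)

text \<open>As soon as the affine space contains a unit vector, its unit vectors form a nonempty compact
  set, so the least value in the definition of \<open>eta\<close> exists.\<close>
lemma
  assumes "z \<in> ensemble_affine J (u 0)" "norm z = 1"
  shows eta_attained: "\<exists>z\<in>ensemble_affine J (u 0). norm z = 1 \<and> eta J u t = z \<bullet> (cov J (u t) *v z)"
    and eta_le: "eta J u t \<le> z \<bullet> (cov J (u t) *v z)"
proof -
  let ?q = "\<lambda>z. z \<bullet> (cov J (u t) *v z)"
  let ?S = "ensemble_affine J (u 0) \<inter> sphere 0 1"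
  have "closed (ensemble_affine J (u 0))"
    unfolding ensemble_affine_def deviation_span_def
    by (intro closed_translation closed_subspace subspace_span)
  then have "compact ?S"
    by (intro closed_Int_compact compact_sphere)
  moreover have "?S \<noteq> {}" using assms by auto
  moreover have "continuous_on ?S ?q" by (intro continuous_intros)
  ultimately obtain x where x: "x \<in> ?S" "\<And>z. z \<in> ?S \<Longrightarrow> ?q x \<le> ?q z"
    using continuous_attains_inf[of ?S ?q] by blast
  have "eta J u t = ?q x"
    unfolding eta_def
  proof (rule Least_equality)
    show "\<exists>z\<in>ensemble_affine J (u 0). norm z = 1 \<and> ?q x = ?q z"
      using x(1) by (intro bexI[of _ x]) auto
    fix r
    assume "\<exists>z\<in>ensemble_affine J (u 0). norm z = 1 \<and> r = ?q z"
    then obtain z where "z \<in> ?S" "r = ?q z" by auto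
    then show "?q x \<le> r" using x(2) by simp
  qed
  then show "\<exists>z\<in>ensemble_affine J (u 0). norm z = 1 \<and> eta J u t = ?q z"
    using x(1) by (intro bexI[of _ x]) auto
  show "eta J u t \<le> ?q z"
    unfolding \<open>eta J u t = ?q x\<close> using assms by (intro x(2)) simp
qed

text \<open>Comparison with \<open>G\<close> of the mean particle instead of the mean of the images avoids a loss of
  constants, because the latter minimizes the sum of squares.\<close>
lemma sum_norm_Lipschitz_deviations_le:
  fixes v :: "nat \<Rightarrow> 'a::real_normed_vector" and G :: "'a \<Rightarrow> 'b::real_inner"
  assumes "J > 0" and Lip: "\<And>x y. dist (G x) (G y) \<le> c * dist x y"
  shows "(\<Sum>j\<in>{1..J}. (norm (G (v j) - mean J (\<lambda>l. G (v l))))\<^sup>2)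
    \<le> c\<^sup>2 * (\<Sum>j\<in>{1..J}. (norm (v j - mean J v))\<^sup>2)"
proof -
  have "(\<Sum>j\<in>{1..J}. (norm (G (v j) - mean J (\<lambda>l. G (v l))))\<^sup>2)
      \<le> (\<Sum>j\<in>{1..J}. (norm (G (v j) - G (mean J v)))\<^sup>2)"
    by (rule sum_norm_deviations_le) fact
  also have "\<dots> \<le> (\<Sum>j\<in>{1..J}. c\<^sup>2 * (norm (v j - mean J v))\<^sup>2)"
  proof (rule sum_mono)
    fix j
    have "norm (G (v j) - G (mean J v)) \<le> c * norm (v j - mean J v)"
      using Lip[of "v j" "mean J v"] by (simp add: dist_norm)
    then have "(norm (G (v j) - G (mean J v)))\<^sup>2 \<le> (c * norm (v j - mean J v))\<^sup>2"
      by (intro power_mono) auto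
    then show "(norm (G (v j) - G (mean J v)))\<^sup>2 \<le> c\<^sup>2 * (norm (v j - mean J v))\<^sup>2"
      by (simp add: power_mult_distrib)
  qed
  finally show ?thesis
    by (simp add: sum_distrib_left)
qed

lemma eki_deviations_flow:
  fixes G :: "real^'d \<Rightarrow> real^'k" and u :: "real \<Rightarrow> nat \<Rightarrow> real^'d"
  assumes sol: "eki_solution J G y \<Gamma> C0 m h dh \<tau> \<rho> u" and "J > 0" "t \<ge> 0" "j \<in> {1..J}"
  shows "((\<lambda>s. u s j - mean J (u s)) has_vector_derivative
    - ((1 / real J) *\<^sub>R (\<Sum>l\<in>{1..J}.
        ((1 - \<rho> t) * ((G (u t l) - mean J (\<lambda>l. G (u t l))) \<bullet> (matrix_inv \<Gamma> *v (G (u t j) - mean J (\<lambda>l. G (u t l)))))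
          + (u t l - mean J (u t)) \<bullet> (matrix_inv C0 *v (u t j - mean J (u t)))) *\<^sub>R (u t l - mean J (u t)))))
    (at t within {0..})"
proof -
  have u': "((\<lambda>s. u s j) has_vector_derivative eki_rhs J G y \<Gamma> C0 m h dh \<tau> (\<rho> t) (u t) j) (at t within {0..})"
    if "j \<in> {1..J}" for j
    using sol \<open>t \<ge> 0\<close> that by (simp add: eki_solution_def)
  have "((\<lambda>s. mean J (u s)) has_vector_derivative
      mean J (eki_rhs J G y \<Gamma> C0 m h dh \<tau> (\<rho> t) (u t))) (at t within {0..})"
    unfolding mean_def
    by (intro bounded_linear.has_vector_derivative[OF bounded_linear_scaleR_right]
        has_vector_derivative_sum u')
  from has_vector_derivative_diff[OF u'[OF \<open>j \<in> {1..J}\<close>] this]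
  show ?thesis
    unfolding eki_rhs_deviation[OF \<open>J > 0\<close>] .
qed

lemma eki_deviation_flow:
  fixes G :: "real^'d \<Rightarrow> real^'k" and u :: "real \<Rightarrow> nat \<Rightarrow> real^'d"
  assumes sol: "eki_solution J G y \<Gamma> C0 m h dh \<tau> \<rho> u" and "J > 0"
    and "locally_lipschitz_const c_lip G"
    and "sym_pos_def \<Gamma>" and "sym_pos_def C0"
    and "\<And>t. t \<ge> 0 \<Longrightarrow> 0 \<le> \<rho> t \<and> \<rho> t \<le> 1" and "(\<rho> \<longlongrightarrow> 1) at_top"
  obtains \<alpha> \<beta> \<gamma> where "deviation_flow J (\<lambda>t j. u t j - mean J (u t))
    (\<lambda>t j. G (u t j) - mean J (\<lambda>l. G (u t l))) (\<lambda>t. 1 - \<rho> t)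
    ((*v) (matrix_inv C0)) ((*v) (matrix_inv \<Gamma>)) \<alpha> \<beta> \<gamma> (c_lip\<^sup>2)"
proof -
  obtain \<alpha> \<beta> where A: "\<alpha> > 0" "\<beta> > 0" "\<And>x. \<alpha> * (norm x)\<^sup>2 \<le> x \<bullet> (matrix_inv C0 *v x)"
      "\<And>x. x \<bullet> (matrix_inv C0 *v x) \<le> \<beta> * (norm x)\<^sup>2"
    using sym_pos_def_bounds[OF sym_pos_def_matrix_inv[OF \<open>sym_pos_def C0\<close>]] by blast
  obtain \<gamma>' \<gamma> where B: "\<gamma>' > 0" "\<gamma> > 0" "\<And>x. \<gamma>' * (norm x)\<^sup>2 \<le> x \<bullet> (matrix_inv \<Gamma> *v x)"
      "\<And>x. x \<bullet> (matrix_inv \<Gamma> *v x) \<le> \<gamma> * (norm x)\<^sup>2"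
    using sym_pos_def_bounds[OF sym_pos_def_matrix_inv[OF \<open>sym_pos_def \<Gamma>\<close>]] by blast
  have B0: "0 \<le> x \<bullet> (matrix_inv \<Gamma> *v x)" for x
    using B(1) B(3)[of x] by (meson mult_nonneg_nonneg less_imp_le order_trans zero_le_power2)
  have "((\<lambda>t. 1 - \<rho> t) \<longlongrightarrow> 1 - 1) at_top"
    by (intro tendsto_intros assms)
  then have r: "((\<lambda>t. 1 - \<rho> t) \<longlongrightarrow> 0) at_top" by simp
  show ?thesis
  proof (rule that[of \<alpha> \<beta> \<gamma>], rule deviation_flow.intro, goal_cases)
    case 4
    then show ?case by (rule eki_deviations_flow[OF sol \<open>J > 0\<close>])
  next
    case 14
    show ?case
      by (rule sum_norm_Lipschitz_deviations_le[OF \<open>J > 0\<close>])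
        (rule dist_le_of_locally_lipschitz_const[OF assms(3)])
  next
    case 7
    show ?case by (rule r)
  next
    case 5
    then show ?case using assms(6) by simp
  next
    case 6
    then show ?case using assms(6) by simp
  qed (rule \<open>J > 0\<close> A B B0 matrix_vector_mul_linear zero_le_power2 less_imp_le[OF B(2)])+
qed

section \<open>Two-sided decay rate and the choice of the time\<close>

text \<open>A unit vector of the affine space is \<open>p + x\<close> with \<open>p\<close> orthogonal to the deviations at all times
  and \<open>x\<close> in their span, of a length that is the same for all such vectors. Positivity of
  \<open>eta J u 0\<close> is what excludes \<open>x = 0\<close>, and then the lower bound on the span carries over with the constant
  multiplied by the square of that length.\<close>
lemma ensemble_covariance_decay_rate:
  fixes G :: "real^'d \<Rightarrow> real^'k" and u :: "real \<Rightarrow> nat \<Rightarrow> real^'d"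
  assumes sol: "eki_solution J G y \<Gamma> C0 m h dh \<tau> \<rho> u" and J: "J > 0"
    and "locally_lipschitz_const c_lip G" "sym_pos_def \<Gamma>" "sym_pos_def C0"
    and "\<And>t. t \<ge> 0 \<Longrightarrow> 0 \<le> \<rho> t \<and> \<rho> t \<le> 1" "(\<rho> \<longlongrightarrow> 1) at_top"
    and eta0: "eta J u 0 > 0" and z0: "z0 \<in> ensemble_affine J (u 0)" "norm z0 = 1"
  obtains T \<kappa> \<mu> where "T > 0" "\<kappa> > 0"
    "\<And>t z. t \<ge> T \<Longrightarrow> z \<in> ensemble_affine J (u 0) \<Longrightarrow> norm z = 1 \<Longrightarrow> \<kappa> / t \<le> z \<bullet> (cov J (u t) *v z)"
    "\<And>t z. t > 0 \<Longrightarrow> norm z = 1 \<Longrightarrow> z \<bullet> (cov J (u t) *v z) \<le> \<mu> / t"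
proof -
  obtain \<alpha> \<beta> \<gamma> where flow: "deviation_flow J (\<lambda>t j. u t j - mean J (u t))
      (\<lambda>t j. G (u t j) - mean J (\<lambda>l. G (u t l))) (\<lambda>t. 1 - \<rho> t)
      ((*v) (matrix_inv C0)) ((*v) (matrix_inv \<Gamma>)) \<alpha> \<beta> \<gamma> (c_lip\<^sup>2)"
    using eki_deviation_flow[OF sol J assms(3-7)] by blast
  interpret deviation_flow J "\<lambda>t j. u t j - mean J (u t)"
    "\<lambda>t j. G (u t j) - mean J (\<lambda>l. G (u t l))" "\<lambda>t. 1 - \<rho> t"
    "(*v) (matrix_inv C0)" "(*v) (matrix_inv \<Gamma>)" \<alpha> \<beta> \<gamma> "c_lip\<^sup>2"
    by (rule flow)
  have cov_q: "z \<bullet> (cov J (u t) *v z) = q t z" for t z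
    by (simp add: inner_cov_mult_vector q_def)
  obtain p where p: "\<And>w. w \<in> E \<Longrightarrow> p \<bullet> w = 0" "ensemble_affine J (u 0) = (\<lambda>x. p + x) ` E"
    using ensemble_affine_decompose[of J "u 0"] unfolding E_def deviation_span_def by metis
  have split: "\<exists>x\<in>E. q t z = q t x \<and> (norm x)\<^sup>2 = 1 - (norm p)\<^sup>2"
    if z: "z \<in> ensemble_affine J (u 0)" "norm z = 1" and "t \<ge> 0" for z t
  proof -
    obtain x where x: "x \<in> E" "z = p + x"
      using z p(2) by blast
    have "p \<bullet> (u t j - mean J (u t)) = 0" if "j \<in> {1..J}" for j
      using p(1) that \<open>t \<ge> 0\<close> by (intro inner_e_eq_0)
    then have "q t z = q t x"
      by (simp add: q_def x(2) inner_add_left)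
    moreover have "1 = (norm p)\<^sup>2 + (norm x)\<^sup>2"
      using norm_add_Pythagorean[of p x] p(1)[OF x(1)] z(2) x(2) by (simp add: orthogonal_def)
    ultimately show ?thesis
      using x(1) by (intro bexI[of _ x]) auto
  qed
  have p_less: "1 - (norm p)\<^sup>2 > 0"
  proof -
    obtain x where x: "q 0 z0 = q 0 x" "(norm x)\<^sup>2 = 1 - (norm p)\<^sup>2"
      using split[OF z0, of 0] by auto
    have "q 0 x > 0"
      using eta_le[of z0 J u 0, OF z0] eta0 x(1) by (simp add: cov_q)
    then have "x \<noteq> 0" by (auto simp: q_def)
    then show ?thesis
      unfolding x(2)[symmetric] by simp
  qed
  obtain T \<kappa> where T: "T > 0" "\<kappa> > 0"
      "\<And>t x. t \<ge> T \<Longrightarrow> x \<in> E \<Longrightarrow> q t x \<ge> \<kappa> * (norm x)\<^sup>2 / t"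
    using q_lower_on_E by blast
  show ?thesis
  proof (rule that[of T "\<kappa> * (1 - (norm p)\<^sup>2)" "1 / (2 * \<alpha>)"])
    show "\<kappa> * (1 - (norm p)\<^sup>2) / t \<le> z \<bullet> (cov J (u t) *v z)"
      if t: "t \<ge> T" and z: "z \<in> ensemble_affine J (u 0)" "norm z = 1" for t z
    proof -
      have "t \<ge> 0" using t T(1) by simp
      then obtain x where "x \<in> E" "q t z = q t x" "(norm x)\<^sup>2 = 1 - (norm p)\<^sup>2"
        using split[OF z] by blast
      then show ?thesis
        using T(3)[OF t, of x] by (simp add: cov_q)
    qed
    show "z \<bullet> (cov J (u t) *v z) \<le> 1 / (2 * \<alpha>) / t" if "t > 0" "norm z = 1" for t z
      using q_decay[OF that] by (simp add: cov_q)
  qed (use T p_less in auto)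
qed

lemma ensemble_var_pos:
  assumes "J > 0" and "z \<bullet> (cov J v *v z) > 0"
  shows "ensemble_var J v > 0"
proof -
  have "(\<Sum>j\<in>{1..J}. (z \<bullet> (v j - mean J v))\<^sup>2) \<noteq> 0"
    using assms by (auto simp: inner_cov_mult_vector)
  then obtain j where "j \<in> {1..J}" "(z \<bullet> (v j - mean J v))\<^sup>2 \<noteq> 0"
    by (rule sum.not_neutral_contains_not_neutral)
  then have "(\<Sum>j\<in>{1..J}. (1/2) * (norm (v j - mean J v))\<^sup>2) > 0"
    by (intro sum_pos2[of _ j]) auto
  then show ?thesis
    using assms(1) by (simp add: ensemble_var_def)
qed

text \<open>The quantity inside \<open>max\<close> grows like \<open>inverse (\<eta> t)\<close>, because \<open>a\<close> and \<open>\<eta>\<close> tend to zero and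
  \<open>b powr a t\<close> tends to one. So the fraction tends to zero and falls below any \<open>\<kappa> > 0\<close>.\<close>
lemma eventually_rate_le:
  fixes a \<eta> :: "real \<Rightarrow> real"
  assumes a: "(a \<longlongrightarrow> 0) at_top" and \<eta>: "(\<eta> \<longlongrightarrow> 0) at_top" "\<forall>\<^sub>F t in at_top. \<eta> t > 0"
    and "b > 0" "c > 0" "\<kappa> > 0"
  shows "\<forall>\<^sub>F t in at_top. 1 - a t > 0 \<and>
    (1 - a t) / (c + (1 - a t) *
      max (((1 - a t) - \<eta> t * c * b) / ((1 - a t) * b powr a t * \<eta> t)) 0) \<le> \<kappa>"
proof -
  \<comment> \<open>The bound amounts to \<open>(1 - a t) / \<kappa> \<le> (1 - a t) * k\<close> for the argument \<open>k\<close> of \<open>max\<close>. Multiplied by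
    \<open>\<eta> t\<close>, this compares a quantity tending to one with a quantity tending to zero.\<close>
  have "((\<lambda>t. (1 - a t - \<eta> t * c * b) / b powr a t - (1 - a t) * \<eta> t / \<kappa>)
      \<longlongrightarrow> (1 - 0 - 0 * c * b) / b powr 0 - (1 - 0) * 0 / \<kappa>) at_top"
    using \<open>b > 0\<close> \<open>\<kappa> > 0\<close> by (intro tendsto_intros a \<eta>) auto
  then have "\<forall>\<^sub>F t in at_top. (1 - a t - \<eta> t * c * b) / b powr a t - (1 - a t) * \<eta> t / \<kappa> > 0"
    by (rule order_tendstoD) (use \<open>b > 0\<close> in simp)
  moreover have "\<forall>\<^sub>F t in at_top. a t < 1"
    using a by (rule order_tendstoD) simp
  ultimately show ?thesis
    using \<eta>(2)
  proof eventually_elim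
    case (elim t)
    define w where "w = 1 - a t"
    define k where "k = (w - \<eta> t * c * b) / (w * b powr a t * \<eta> t)"
    have w: "w > 0" using elim by (simp add: w_def)
    have "w * \<eta> t / \<kappa> < w * k * \<eta> t"
      using elim w \<open>b > 0\<close> by (simp add: k_def flip: w_def)
    then have "w / \<kappa> < w * k"
      using elim(3) by (metis mult_less_cancel_right_pos times_divide_eq_left)
    also have "\<dots> \<le> c + w * max k 0"
      using w \<open>c > 0\<close> by (smt (verit) mult_left_mono max.cobounded1)
    finally have "w < \<kappa> * (c + w * max k 0)"
      using \<open>\<kappa> > 0\<close> by (simp add: pos_divide_less_eq mult.commute)
    moreover have "c + w * max k 0 > 0"
      using w \<open>c > 0\<close> by (simp add: add_pos_nonneg)
    ultimately have "w / (c + w * max k 0) \<le> \<kappa>"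
      by (simp add: pos_divide_le_eq)
    with w show ?case
      by (simp add: k_def w_def)
  qed
qed

theorem lemma3p2:
  fixes G :: "real^'d \<Rightarrow> real^'k" and y :: "real^'k"
    and \<Gamma> :: "real^'k^'k" and C0 :: "real^'d^'d"
    and m :: nat and h :: "nat \<Rightarrow> real^'d \<Rightarrow> real" and dh :: "nat \<Rightarrow> real^'d \<Rightarrow> real^'d"
    and J :: nat and u :: "real \<Rightarrow> nat \<Rightarrow> real^'d"
    and \<rho> :: "real \<Rightarrow> real" and \<tau> c_lip :: real
  assumes "c_lip > 0" and "locally_lipschitz_const c_lip G"
    and "sym_pos_def \<Gamma>" and "sym_pos_def C0"
    and "\<And>i. i \<in> {1..m} \<Longrightarrow> convex_on UNIV (h i)"
    and "\<And>i x. i \<in> {1..m} \<Longrightarrow> GDERIV (h i) x :> dh i x"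
    and "\<And>i. i \<in> {1..m} \<Longrightarrow> continuous_on UNIV (dh i)"
    and "\<exists>x. \<forall>i\<in>{1..m}. h i x < 0"
    and "\<tau> > 0" and "J \<ge> 2"
    and "\<And>t. t \<ge> 0 \<Longrightarrow> 0 \<le> \<rho> t \<and> \<rho> t \<le> 1" and "(\<rho> \<longlongrightarrow> 1) at_top"
    and "\<And>j. j \<in> {1..J} \<Longrightarrow> u 0 j \<in> feasible_set m h"
    and "eki_solution J G y \<Gamma> C0 m h dh \<tau> \<rho> u"
    and "eta J u 0 > 0"
  shows "\<forall>z\<in>ensemble_affine J (u 0). norm z = 1 \<longrightarrow>
    (\<exists>t0>0.
      let s_min = Min (eigenvalues (matrix_inv C0));
          s_max = Max (eigenvalues (matrix_inv C0));
          l_max = Max (eigenvalues (matrix_inv \<Gamma>));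
          a = (1 - \<rho> t0) * c_lip\<^sup>2 * l_max * real J / s_min;
          b = inverse (ensemble_var J (u 0)) * real J / (2 * s_min);
          c = 2 * s_max;
          k1 = ((1 - a) - eta J u t0 * c * b) / ((1 - a) * b powr a * eta J u t0);
          w = 1 - a
      in w > 0 \<and> eta J u t0 \<noteq> 0 \<and>
         (\<forall>t\<ge>t0. z \<bullet> (cov J (u t) *v z) \<ge> w / ((c + w * max k1 0) * (t + b))))"
proof (intro ballI impI, goal_cases)
  case z: (1 z)
  have J: "J > 0" using \<open>J \<ge> 2\<close> by simp
  obtain T \<kappa> \<mu> where T: "T > 0" "\<kappa> > 0"
      and lower: "\<And>t z. t \<ge> T \<Longrightarrow> z \<in> ensemble_affine J (u 0) \<Longrightarrow> norm z = 1 \<Longrightarrow>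
        \<kappa> / t \<le> z \<bullet> (cov J (u t) *v z)"
      and upper: "\<And>t z. t > 0 \<Longrightarrow> norm z = 1 \<Longrightarrow> z \<bullet> (cov J (u t) *v z) \<le> \<mu> / t"
    using ensemble_covariance_decay_rate[OF assms(14) J assms(2-4) assms(11,12,15) z] by blast
  have eta_lower: "\<kappa> / t \<le> eta J u t" if "t \<ge> T" for t
    using eta_attained[of z J u t, OF z] lower[OF that] by auto
  have eta_upper: "eta J u t \<le> \<mu> / t" if "t > 0" for t
    using eta_le[of z J u t, OF z] upper[OF that z(2)] by simp
  have eta_pos: "eta J u t > 0" if "t \<ge> T" for t
    using eta_lower[OF that] T that by (smt (verit) divide_pos_pos)
  have rate: "((\<lambda>t. \<mu> / t) \<longlongrightarrow> 0) at_top"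
    by (intro tendsto_divide_0[OF tendsto_const] filterlim_at_top_imp_at_infinity filterlim_ident)
  have eta_eventually_pos: "\<forall>\<^sub>F t in at_top. eta J u t > 0"
    using eventually_ge_at_top[of T] by eventually_elim (rule eta_pos)
  have "\<forall>\<^sub>F t in at_top. 0 \<le> eta J u t"
    using eta_eventually_pos by eventually_elim simp
  moreover have "\<forall>\<^sub>F t in at_top. eta J u t \<le> \<mu> / t"
    using eventually_gt_at_top[of 0] by eventually_elim (rule eta_upper)
  ultimately have eta_tendsto: "(eta J u \<longlongrightarrow> 0) at_top"
    by (rule tendsto_sandwich[OF _ _ tendsto_const rate])
  define s_min where "s_min = Min (eigenvalues (matrix_inv C0))"
  define s_max where "s_max = Max (eigenvalues (matrix_inv C0))"
  define l_max where "l_max = Max (eigenvalues (matrix_inv \<Gamma>))"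
  note ev = sym_pos_def_eigenvalues[OF sym_pos_def_matrix_inv[OF \<open>sym_pos_def C0\<close>]]
  have s: "s_min > 0" "s_max > 0"
    unfolding s_min_def s_max_def using ev(3)[OF Min_in[OF ev(1,2)]] ev(3)[OF Max_in[OF ev(1,2)]]
    by blast+
  define a where "a t = (1 - \<rho> t) * c_lip\<^sup>2 * l_max * real J / s_min" for t
  define b where "b = inverse (ensemble_var J (u 0)) * real J / (2 * s_min)"
  define c where "c = 2 * s_max"
  define k1 where "k1 t = ((1 - a t) - eta J u t * c * b) / ((1 - a t) * b powr a t * eta J u t)" for t
  have "ensemble_var J (u 0) > 0"
    using ensemble_var_pos[OF J, of z] eta_le[of z J u 0, OF z] \<open>eta J u 0 > 0\<close> by simp
  then have b: "b > 0"
    using J s by (simp add: b_def)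
  have c: "c > 0"
    using s by (simp add: c_def)
  have "(a \<longlongrightarrow> (1 - 1) * c_lip\<^sup>2 * l_max * real J / s_min) at_top"
    unfolding a_def using s by (intro tendsto_intros assms) auto
  then have a: "(a \<longlongrightarrow> 0) at_top" by simp
  \<comment> \<open>Late enough, the constant in the claimed bound is below the constant \<open>\<kappa>\<close> of the decay rate.\<close>
  have "\<forall>\<^sub>F t in at_top. 1 - a t > 0 \<and> (1 - a t) / (c + (1 - a t) * max (k1 t) 0) \<le> \<kappa>"
    unfolding k1_def
    by (rule eventually_rate_le[OF a eta_tendsto eta_eventually_pos b c \<open>\<kappa> > 0\<close>])
  then have "\<forall>\<^sub>F t in at_top. t \<ge> T \<and> 1 - a t > 0 \<and>
      (1 - a t) / (c + (1 - a t) * max (k1 t) 0) \<le> \<kappa>"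
    using eventually_ge_at_top[of T] by eventually_elim auto
  then obtain t0 where t0: "t0 \<ge> T" "1 - a t0 > 0"
      "(1 - a t0) / (c + (1 - a t0) * max (k1 t0) 0) \<le> \<kappa>"
    using eventually_happens'[OF trivial_limit_at_top_linorder] by blast
  have bound: "(1 - a t0) / ((c + (1 - a t0) * max (k1 t0) 0) * (t + b)) \<le> z \<bullet> (cov J (u t) *v z)"
    if "t \<ge> t0" for t
  proof -
    have t: "t > 0" "t \<ge> T" using that t0(1) T(1) by auto
    have "(1 - a t0) / ((c + (1 - a t0) * max (k1 t0) 0) * (t + b))
        = (1 - a t0) / (c + (1 - a t0) * max (k1 t0) 0) / (t + b)"
      by simp
    also have "\<dots> \<le> \<kappa> / (t + b)"
      using t0(3) t(1) b by (intro divide_right_mono) auto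
    also have "\<dots> \<le> \<kappa> / t"
      using t(1) b T(2) by (intro divide_left_mono) auto
    also have "\<dots> \<le> z \<bullet> (cov J (u t) *v z)"
      by (rule lower[OF t(2) z])
    finally show ?thesis .
  qed
  have t0_pos: "t0 > 0"
    using t0(1) T(1) by simp
  have eta_nz: "eta J u t0 \<noteq> 0"
    using eta_pos[OF t0(1)] by simp
  have "t0 > 0 \<and> 1 - a t0 > 0 \<and> eta J u t0 \<noteq> 0 \<and> (\<forall>t\<ge>t0. z \<bullet> (cov J (u t) *v z)
      \<ge> (1 - a t0) / ((c + (1 - a t0) * max (k1 t0) 0) * (t + b)))"
    by (intro conjI allI impI t0_pos t0(2) eta_nz bound)
  then show ?case
    unfolding Let_def k1_def a_def b_def c_def s_min_def s_max_def l_max_def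
    by (intro exI[of _ t0])
qed

end
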